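(* Fix schemes $\sigma, \tau$ and assume that $\sigma$ is a retract of $\tau$. Let $T$ be any countable collection of schemes. Then (1) if $\tau$ is (standalone) categorical in $T$, then $\sigma$ is (standalone) categorical in $T$; (2) if $\tau$ is (standalone) complete in $T$, then $\sigma$ is (standalone) complete in $T$.
   Context: A scheme is a sentence with a distinguished predicate variable $P$. For a countable collection of schemes $T$, $\mathrm{PC}(T)$ (predicative comprehension over $T$) is the theory whose models are pairs $(\mathcal{M},\mathcal{X})$, where $\mathcal{M}$ is a first-order structure and $\mathcal{X}$ is a family of subsets (of powers) of $M$ containing every set definable in $\mathcal{M}$ by a first-order formula with first-order parameters from $M$ and second-order parameters from $\mathcal{X}$, such that every instance of the schemes in $T$ with $P$ replaced by a member of $\mathcal{X}$ holds. The standalone version $\mathrm{sPC}(T)$ is defined in the same way, except that comprehension is required only for formulas without first-order parameters. Given $(\mathcal{M},\mathcal{X})$, an $\mathcal{X}$-strong model of a scheme $\tau$ is a structure whose domain, equality and relations belong to $\mathcal{X}$ and which satisfies every instance of $\tau$ with $P$ replaced by any member of $\mathcal{X}$. $\tau$ is categorical (resp. complete) in $T$ if for every $(\mathcal{M},\mathcal{X})\models \mathrm{PC}(T)$ any two $\mathcal{X}$-strong models of $\tau$ are isomorphic via an isomorphism in $\mathcal{X}$ (resp. elementarily equivalent); the standalone variants use $\mathrm{sPC}(T)$ instead. $\sigma$ is a retract of $\tau$ if there are interpretations $\mathtt{t}:\sigma\rhd\tau$ and $\mathtt{s}:\tau\rhd\sigma$ such that $\mathrm{sPC}(\sigma)$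 proves the existence of an isomorphism $F: V\to V^{\mathtt{t}\mathtt{s}}$ between the ground structure and its image under the composite interpretation. *)

theory Defs
  imports "HOL-Library.Countable_Set"
begin

text \<open>
  Formulas of relational languages with equality. A relation symbol is a pair consisting of a name
  and an arity; the arity of an atom is the length of its argument list. Besides the symbols of the
  language there are predicate variables, which are never quantified: they stand for the
  distinguished predicate variable of a scheme and for second-order parameters.
\<close>

datatype 'r fm =
    FEq nat nat
  | FRel 'r "nat list"
  | FPred nat "nat list"
  | FNeg "'r fm"
  | FConj "'r fm" "'r fm"
  | FAll nat "'r fm"

primrec fv :: "'r fm \<Rightarrow> nat set" where
  "fv (FEq i j) = {i, j}"
| "fv (FRel r xs) = set xs"
| "fv (FPred p xs) = set xs"
| "fv (FNeg \<phi>) = fv \<phi>"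
| "fv (FConj \<phi> \<psi>) = fv \<phi> \<union> fv \<psi>"
| "fv (FAll i \<phi>) = fv \<phi> - {i}"

primrec lang :: "'r fm \<Rightarrow> ('r \<times> nat) set" where
  "lang (FEq i j) = {}"
| "lang (FRel r xs) = {(r, length xs)}"
| "lang (FPred p xs) = {}"
| "lang (FNeg \<phi>) = lang \<phi>"
| "lang (FConj \<phi> \<psi>) = lang \<phi> \<union> lang \<psi>"
| "lang (FAll i \<phi>) = lang \<phi>"

primrec pvars :: "'r fm \<Rightarrow> (nat \<times> nat) set" where
  "pvars (FEq i j) = {}"
| "pvars (FRel r xs) = {}"
| "pvars (FPred p xs) = {(p, length xs)}"
| "pvars (FNeg \<phi>) = pvars \<phi>"
| "pvars (FConj \<phi> \<psi>) = pvars \<phi> \<union> pvars \<psi>"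
| "pvars (FAll i \<phi>) = pvars \<phi>"

text \<open>The distinguished predicate variable of a scheme is number \<open>0\<close>; it has one fixed arity.\<close>

definition scheme :: "'r fm \<Rightarrow> bool" where
  "scheme \<sigma> \<longleftrightarrow> fv \<sigma> = {} \<and> (\<exists>k. pvars \<sigma> \<subseteq> {(0, k)})"

text \<open>
  Structures carry their own equality, which need not be the identity. For a symbol outside the
  language under consideration the value of \<open>Rl\<close> is irrelevant.
\<close>

record ('r, 'b) struct =
  Dom :: "'b set"
  Eqv :: "('b \<times> 'b) set"
  Rl :: "'r \<Rightarrow> nat \<Rightarrow> 'b list set"

definition tuples :: "nat \<Rightarrow> 'b set \<Rightarrow> 'b list set" where
  "tuples n D = {xs. length xs = n \<and> set xs \<subseteq> D}"

definition compat :: "('b \<times> 'b) set \<Rightarrow> 'b list set \<Rightarrow> bool" where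
  "compat E R \<longleftrightarrow>
     (\<forall>xs ys. xs \<in> R \<and> list_all2 (\<lambda>x y. (x, y) \<in> E) xs ys \<longrightarrow> ys \<in> R)"

definition is_struct :: "('r \<times> nat) set \<Rightarrow> ('r, 'b) struct \<Rightarrow> bool" where
  "is_struct L A \<longleftrightarrow>
     Dom A \<noteq> {} \<and> equiv (Dom A) (Eqv A) \<and>
     (\<forall>(r, n)\<in>L. Rl A r n \<subseteq> tuples n (Dom A) \<and> compat (Eqv A) (Rl A r n))"

primrec sat :: "('r, 'b) struct \<Rightarrow> (nat \<Rightarrow> 'b list set) \<Rightarrow> (nat \<Rightarrow> 'b) \<Rightarrow> 'r fm \<Rightarrow> bool" where
  "sat A V s (FEq i j) \<longleftrightarrow> (s i, s j) \<in> Eqv A"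
| "sat A V s (FRel r xs) \<longleftrightarrow> map s xs \<in> Rl A r (length xs)"
| "sat A V s (FPred p xs) \<longleftrightarrow> map s xs \<in> V p"
| "sat A V s (FNeg \<phi>) \<longleftrightarrow> \<not> sat A V s \<phi>"
| "sat A V s (FConj \<phi> \<psi>) \<longleftrightarrow> sat A V s \<phi> \<and> sat A V s \<psi>"
| "sat A V s (FAll i \<phi>) \<longleftrightarrow> (\<forall>x\<in>Dom A. sat A V (s(i := x)) \<phi>)"

text \<open>Used for sentences only, whose truth does not depend on the assignment.\<close>

definition holds :: "('r, 'b) struct \<Rightarrow> (nat \<Rightarrow> 'b list set) \<Rightarrow> 'r fm \<Rightarrow> bool" where
  "holds A V \<phi> \<longleftrightarrow> (\<forall>s. sat A V s \<phi>)"

definition elem_equiv :: "('r \<times> nat) set \<Rightarrow> ('r, 'b) struct \<Rightarrow> ('r, 'c) struct \<Rightarrow> bool" where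
  "elem_equiv L A B \<longleftrightarrow>
     (\<forall>\<phi>. fv \<phi> = {} \<and> pvars \<phi> = {} \<and> lang \<phi> \<subseteq> L \<longrightarrow>
        (holds A (\<lambda>_. {}) \<phi> \<longleftrightarrow> holds B (\<lambda>_. {}) \<phi>))"

text \<open>\<open>F\<close> is the graph of a map modulo the equalities of the two structures.\<close>

definition is_iso ::
  "('r \<times> nat) set \<Rightarrow> ('r, 'b) struct \<Rightarrow> ('r, 'c) struct \<Rightarrow> ('b \<times> 'c) set \<Rightarrow> bool" where
  "is_iso L A B F \<longleftrightarrow>
     F \<subseteq> Dom A \<times> Dom B \<and>
     (\<forall>a\<in>Dom A. \<exists>b. (a, b) \<in> F) \<and> (\<forall>b\<in>Dom B. \<exists>a. (a, b) \<in> F) \<and>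
     (\<forall>(a, b)\<in>F. \<forall>(a', b')\<in>F. (a, a') \<in> Eqv A \<longleftrightarrow> (b, b') \<in> Eqv B) \<and>
     (\<forall>(r, n)\<in>L. \<forall>xs ys. length xs = n \<and> list_all2 (\<lambda>a b. (a, b) \<in> F) xs ys \<longrightarrow>
        (xs \<in> Rl A r n \<longleftrightarrow> ys \<in> Rl B r n))"

text \<open>
  In the comprehension conditions the variables \<open>0, \<dots>, n - 1\<close> define the set and the following ones
  hold the first-order parameters \<open>ps\<close>.
\<close>

definition comprehension :: "('r \<times> nat) set \<Rightarrow> ('r, 'a) struct \<Rightarrow> 'a list set set \<Rightarrow> bool" where
  "comprehension L M X \<longleftrightarrow>
     (\<forall>\<phi> n V ps. lang \<phi> \<subseteq> L \<and> (\<forall>(p, k)\<in>pvars \<phi>. V p \<in> X) \<and>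
        set ps \<subseteq> Dom M \<and> fv \<phi> \<subseteq> {..<n + length ps} \<longrightarrow>
        {xs \<in> tuples n (Dom M). sat M V (nth (xs @ ps)) \<phi>} \<in> X)"

definition standalone_comprehension ::
  "('r \<times> nat) set \<Rightarrow> ('r, 'a) struct \<Rightarrow> 'a list set set \<Rightarrow> bool" where
  "standalone_comprehension L M X \<longleftrightarrow>
     (\<forall>\<phi> n V. lang \<phi> \<subseteq> L \<and> (\<forall>(p, k)\<in>pvars \<phi>. V p \<in> X) \<and> fv \<phi> \<subseteq> {..<n} \<longrightarrow>
        {xs \<in> tuples n (Dom M). sat M V (nth xs) \<phi>} \<in> X)"

text \<open>
  \<open>M\<close> is an ordinary structure (its equality is the identity), \<open>X\<close> a family of subsets of powers
  of its domain. In an instance of a scheme, a member of \<open>X\<close> whose arity is not that of the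
  predicate variable acts like the empty set, which is in \<open>X\<close> by comprehension.
\<close>

definition ground_model :: "'r fm set \<Rightarrow> ('r, 'a) struct \<Rightarrow> 'a list set set \<Rightarrow> bool" where
  "ground_model T M X \<longleftrightarrow>
     is_struct (\<Union>(lang ` T)) M \<and> Eqv M = Id_on (Dom M) \<and>
     (\<forall>R\<in>X. \<exists>n. R \<subseteq> tuples n (Dom M)) \<and>
     (\<forall>\<theta>\<in>T. \<forall>R\<in>X. holds M (\<lambda>_. R) \<theta>)"

definition PC :: "'r fm set \<Rightarrow> ('r, 'a) struct \<Rightarrow> 'a list set set \<Rightarrow> bool" where
  "PC T M X \<longleftrightarrow> ground_model T M X \<and> comprehension (\<Union>(lang ` T)) M X"

definition sPC :: "'r fm set \<Rightarrow> ('r, 'a) struct \<Rightarrow> 'a list set set \<Rightarrow> bool" where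
  "sPC T M X \<longleftrightarrow> ground_model T M X \<and> standalone_comprehension (\<Union>(lang ` T)) M X"

text \<open>
  The elements of an \<open>X\<close>-strong model are \<open>d\<close>-tuples over the ground structure, and an \<open>n\<close>-ary
  relation on it is identified with a set of \<open>(d * n)\<close>-tuples by concatenation. As the equality of
  the model need not be the identity, the predicate variable ranges over those members of \<open>X\<close> that
  are predicates on the model, i.e. relations on its domain compatible with its equality (otherwise
  the laws of equality would fail for the instances).
\<close>

definition strong_model :: "'a list set set \<Rightarrow> ('r, 'a list) struct \<Rightarrow> 'r fm \<Rightarrow> bool" where
  "strong_model X A \<tau> \<longleftrightarrow>
     is_struct (lang \<tau>) A \<and> (\<exists>d>0. \<forall>a\<in>Dom A. length a = d) \<and>
     Dom A \<in> X \<and> {a @ b | a b. (a, b) \<in> Eqv A} \<in> X \<and>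
     (\<forall>(r, n)\<in>lang \<tau>. concat ` Rl A r n \<in> X) \<and>
     (\<forall>k R. R \<subseteq> tuples k (Dom A) \<and> compat (Eqv A) R \<and> concat ` R \<in> X \<longrightarrow>
        holds A (\<lambda>_. R) \<tau>)"

definition strong_models_isomorphic :: "'a list set set \<Rightarrow> 'r fm \<Rightarrow> bool" where
  "strong_models_isomorphic X \<tau> \<longleftrightarrow>
     (\<forall>A B. strong_model X A \<tau> \<and> strong_model X B \<tau> \<longrightarrow>
        (\<exists>F. is_iso (lang \<tau>) A B F \<and> {a @ b | a b. (a, b) \<in> F} \<in> X))"

definition strong_models_equivalent :: "'a list set set \<Rightarrow> 'r fm \<Rightarrow> bool" where
  "strong_models_equivalent X \<tau> \<longleftrightarrow>
     (\<forall>A B. strong_model X A \<tau> \<and> strong_model X B \<tau> \<longrightarrow> elem_equiv (lang \<tau>) A B)"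

text \<open>
  Quantification over all models becomes quantification over all models whose domain is a subset
  of the universe type \<open>'a\<close>, which the following notions take as an argument.
\<close>

definition categorical :: "'a itself \<Rightarrow> 'r fm \<Rightarrow> 'u fm set \<Rightarrow> bool" where
  "categorical U \<tau> T \<longleftrightarrow>
     (\<forall>(M :: ('u, 'a) struct) X. PC T M X \<longrightarrow> strong_models_isomorphic X \<tau>)"

definition standalone_categorical :: "'a itself \<Rightarrow> 'r fm \<Rightarrow> 'u fm set \<Rightarrow> bool" where
  "standalone_categorical U \<tau> T \<longleftrightarrow>
     (\<forall>(M :: ('u, 'a) struct) X. sPC T M X \<longrightarrow> strong_models_isomorphic X \<tau>)"

definition complete :: "'a itself \<Rightarrow> 'r fm \<Rightarrow> 'u fm set \<Rightarrow> bool" where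
  "complete U \<tau> T \<longleftrightarrow>
     (\<forall>(M :: ('u, 'a) struct) X. PC T M X \<longrightarrow> strong_models_equivalent X \<tau>)"

definition standalone_complete :: "'a itself \<Rightarrow> 'r fm \<Rightarrow> 'u fm set \<Rightarrow> bool" where
  "standalone_complete U \<tau> T \<longleftrightarrow>
     (\<forall>(M :: ('u, 'a) struct) X. sPC T M X \<longrightarrow> strong_models_equivalent X \<tau>)"

text \<open>
  Translations of the language \<open>L\<close> into the language \<open>K\<close>: multidimensional, relativised, not
  necessarily preserving equality, without parameters.
\<close>

record ('t, 's) transl =
  dim :: nat
  dom_fm :: "'s fm"
  eq_fm :: "'s fm"
  rel_fm :: "'t \<Rightarrow> nat \<Rightarrow> 's fm"

definition fo_fm :: "('s \<times> nat) set \<Rightarrow> nat \<Rightarrow> 's fm \<Rightarrow> bool" where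
  "fo_fm K n \<phi> \<longleftrightarrow> lang \<phi> \<subseteq> K \<and> pvars \<phi> = {} \<and> fv \<phi> \<subseteq> {..<n}"

definition is_transl :: "('t \<times> nat) set \<Rightarrow> ('s \<times> nat) set \<Rightarrow> ('t, 's) transl \<Rightarrow> bool" where
  "is_transl L K t \<longleftrightarrow>
     dim t > 0 \<and> fo_fm K (dim t) (dom_fm t) \<and> fo_fm K (dim t + dim t) (eq_fm t) \<and>
     (\<forall>(r, n)\<in>L. fo_fm K (n * dim t) (rel_fm t r n))"

definition interp_dom :: "('t, 's) transl \<Rightarrow> ('s, 'b) struct \<Rightarrow> 'b list set" where
  "interp_dom t M = {a \<in> tuples (dim t) (Dom M). sat M (\<lambda>_. {}) (nth a) (dom_fm t)}"

definition interp :: "('t, 's) transl \<Rightarrow> ('s, 'b) struct \<Rightarrow> ('t, 'b list) struct" where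
  "interp t M =
     \<lparr>Dom = interp_dom t M,
      Eqv = {(a, b). a \<in> interp_dom t M \<and> b \<in> interp_dom t M \<and>
               sat M (\<lambda>_. {}) (nth (a @ b)) (eq_fm t)},
      Rl = (\<lambda>r n. {as \<in> tuples n (interp_dom t M).
               sat M (\<lambda>_. {}) (nth (concat as)) (rel_fm t r n)})\<rparr>"

text \<open>
  \<open>t\<close> interprets \<open>\<tau>\<close> in \<open>\<sigma>\<close>: the standalone theory of \<open>\<sigma>\<close> proves that the structure defined by
  \<open>t\<close> satisfies all instances of \<open>\<tau>\<close>. That this theory proves something means truth in all its
  models; by the downward Loewenheim-Skolem theorem, models with domain in an arbitrary infinite
  type \<open>'a\<close> suffice (pairs \<open>(M, X)\<close> are two-sorted first-order structures and the language of
  \<open>\<sigma>\<close> is finite).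
\<close>

definition interprets :: "'a itself \<Rightarrow> 's fm \<Rightarrow> 't fm \<Rightarrow> ('t, 's) transl \<Rightarrow> bool" where
  "interprets U \<sigma> \<tau> t \<longleftrightarrow>
     is_transl (lang \<tau>) (lang \<sigma>) t \<and>
     (\<forall>(M :: ('s, 'a) struct) X. sPC {\<sigma>} M X \<longrightarrow> strong_model X (interp t M) \<tau>)"

text \<open>
  The composite interpretation yields a structure whose elements are tuples of tuples; they are
  flattened when the isomorphism is required to be a member of \<open>X\<close>.
\<close>

definition retract :: "'a itself \<Rightarrow> 's fm \<Rightarrow> 't fm \<Rightarrow> bool" where
  "retract U \<sigma> \<tau> \<longleftrightarrow>
     (\<exists>t s. interprets U \<sigma> \<tau> t \<and> interprets U \<tau> \<sigma> s \<and>
        (\<forall>(M :: ('s, 'a) struct) X. sPC {\<sigma>} M X \<longrightarrow>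
           (\<exists>F. is_iso (lang \<sigma>) M (interp s (interp t M)) F \<and>
                {x # concat b | x b. (x, b) \<in> F} \<in> X)))"

end

theory Submission
  imports Defs
begin

text \<open>
  A strong model \<open>A\<close> of \<open>\<sigma>\<close> in \<open>X\<close>, divided by its equality and equipped with those members of \<open>X\<close>
  that are relations on \<open>A\<close>, is a model of standalone comprehension over \<open>\<sigma>\<close>. As finite tuples over
  an infinite type inject into that type, this model can be placed on the universe \<open>'a\<close> itself, so
  the hypotheses on the translations \<open>t\<close> and \<open>s\<close> apply to it: the structure \<open>B\<close> defined by \<open>t\<close> in \<open>A\<close> is
  a strong model of \<open>\<tau>\<close>, and \<open>A\<close> is isomorphic within \<open>X\<close> to the structure defined by \<open>s\<close> in \<open>B\<close>. An
  isomorphism of two such structures \<open>B\<close> induces one of the structures defined by \<open>s\<close>, hence of the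
  original models of \<open>\<sigma>\<close>; likewise elementary equivalence descends along the translation \<open>s\<close>.
\<close>

section \<open>Families closed under definability\<close>

text \<open>A ground model has literal identity as its equality and single points of the universe as
  elements, whereas a strong model consists of tuples with an equality of its own; the quotient
  removes this mismatch. The projection \<open>q\<close> to the quotient rests on choices and on an
  arbitrary injection, so it cannot be expected to be definable; only its kernel, the equality of
  \<open>A\<close>, is visible to \<open>X\<close>. Whatever is obtained over the quotient is
  therefore carried back as an inverse image: the model of \<open>\<tau>\<close> is not built from
  representatives, but consists of all flattened tuples whose classes lie in the interpreted
  structure, with the induced equality. The price is bookkeeping with words: a relation on tuples
  belongs to \<open>X\<close> only in flattened form, and flattening is harmless because the blocks
  have one fixed positive length. Comprehension is used through closure properties instead of
  formulas, since these pass to relations on blocks without a translation of syntax. First-order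
  parameters never enter, so one argument over standalone comprehension serves all four
  claims.\<close>

lemma tuples_0 [simp]: "tuples 0 D = {[]}"
  by (auto simp: tuples_def)

lemma tuples_appendI: "xs \<in> tuples n D \<Longrightarrow> ys \<in> tuples m D \<Longrightarrow> xs @ ys \<in> tuples (n + m) D"
  by (auto simp: tuples_def)

lemma tuples_lists: "tuples n D \<subseteq> lists D"
  by (auto simp: tuples_def)

lemma map_nth_append_left: "length xs = n \<Longrightarrow> map (nth (xs @ ys)) [0..<n] = xs"
  by (rule nth_equalityI) (auto simp: nth_append)

lemma map_nth_append_right:
  "length xs = n \<Longrightarrow> length ys = m \<Longrightarrow> map (nth (xs @ ys)) [n..<n + m] = ys"
  by (rule nth_equalityI) (auto simp: nth_append)

lemma map_nth_append_mid:
  "length xs = n \<Longrightarrow> length ys = m \<Longrightarrow> map (nth (xs @ ys @ zs)) [n..<n + m] = ys"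
  by (rule nth_equalityI) (auto simp: nth_append)

lemma tuples_appendE:
  assumes "w \<in> tuples (n + m) D"
  obtains xs ys where "w = xs @ ys" "xs \<in> tuples n D" "ys \<in> tuples m D"
proof
  show "w = take n w @ drop n w" by simp
  show "take n w \<in> tuples n D" "drop n w \<in> tuples m D"
    using assms by (auto simp: tuples_def dest: in_set_takeD in_set_dropD)
qed

text \<open>
  A first-order formula over members of \<open>X\<close> defines a member of \<open>X\<close> as soon as \<open>X\<close> has these closure
  properties, so they can replace comprehension by formulas.
\<close>

locale definable_family =
  fixes D :: "'b set" and X :: "'b list set set"
  assumes mem_tuples: "R \<in> X \<Longrightarrow> \<exists>n. R \<subseteq> tuples n D"
    and diff: "R \<in> X \<Longrightarrow> {xs \<in> tuples n D. xs \<notin> R} \<in> X"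
    and inter: "R \<in> X \<Longrightarrow> S \<in> X \<Longrightarrow> R \<inter> S \<in> X"
    and reindex: "R \<in> X \<Longrightarrow> set g \<subseteq> {..<n} \<Longrightarrow> {xs \<in> tuples n D. map (nth xs) g \<in> R} \<in> X"
    and all: "R \<in> X \<Longrightarrow> {xs \<in> tuples n D. \<forall>x\<in>D. xs @ [x] \<in> R} \<in> X"

lemma sat_cong:
  "(\<And>i. i \<in> fv \<phi> \<Longrightarrow> s i = s' i) \<Longrightarrow> (\<And>p k. (p, k) \<in> pvars \<phi> \<Longrightarrow> V p = W p) \<Longrightarrow>
    sat A V s \<phi> \<longleftrightarrow> sat A W s' \<phi>"
proof (induction \<phi> arbitrary: s s')
  case (FRel r xs)
  then have "map s xs = map s' xs" by simp
  then show ?case by (simp only: sat.simps)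
next
  case (FPred p xs)
  then have "map s xs = map s' xs" "V p = W p" by auto
  then show ?case by (simp only: sat.simps)
next
  case (FConj \<phi> \<psi>)
  then show ?case by simp blast
next
  case (FAll i \<phi>)
  have "sat A V (s(i := x)) \<phi> \<longleftrightarrow> sat A W (s'(i := x)) \<phi>" for x
    using FAll.prems by (intro FAll.IH) auto
  then show ?case by simp
qed auto

context definable_family
begin

text \<open>Induction on the formula, with one closure property per constructor. \<open>A\<close> is
  any structure on \<open>D\<close> with ingredients in \<open>X\<close> and may have an equality of
  its own, so that the result also applies to strong models after a change of family.\<close>

lemma definable_sat:
  assumes "Dom A = D" "{[a, b] | a b. (a, b) \<in> Eqv A} \<in> X"
    and "\<And>r k. (r, k) \<in> lang \<phi> \<Longrightarrow> Rl A r k \<in> X"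
    and "\<And>p k. (p, k) \<in> pvars \<phi> \<Longrightarrow> V p \<in> X" and "fv \<phi> \<subseteq> {..<n}"
  shows "{xs \<in> tuples n D. sat A V (nth xs) \<phi>} \<in> X"
  using assms(3-)
proof (induction \<phi> arbitrary: n)
  case (FEq i j)
  have "{xs \<in> tuples n D. map (nth xs) [i, j] \<in> {[a, b] | a b. (a, b) \<in> Eqv A}} \<in> X"
    using FEq by (intro reindex assms) auto
  then show ?case by simp
next
  case (FRel r ys)
  then have "{xs \<in> tuples n D. map (nth xs) ys \<in> Rl A r (length ys)} \<in> X"
    by (intro reindex) auto
  then show ?case by simp
next
  case (FPred p ys)
  then have "{xs \<in> tuples n D. map (nth xs) ys \<in> V p} \<in> X"
    by (intro reindex) auto
  then show ?case by simp
next
  case (FNeg \<phi>)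
  then have "{xs \<in> tuples n D. xs \<notin> {xs \<in> tuples n D. sat A V (nth xs) \<phi>}} \<in> X"
    by (intro diff FNeg.IH) auto
  then show ?case by (rule back_subst[of "\<lambda>S. S \<in> X"]) auto
next
  case (FConj \<phi> \<psi>)
  then have "{xs \<in> tuples n D. sat A V (nth xs) \<phi>} \<inter> {xs \<in> tuples n D. sat A V (nth xs) \<psi>} \<in> X"
    by (intro inter FConj.IH) (simp_all, blast+)
  then show ?case by (rule back_subst[of "\<lambda>S. S \<in> X"]) auto
next
  case (FAll i \<phi>)
  \<comment> \<open>\<open>i\<close> may be any variable; \<open>g\<close> moves it to position \<open>n\<close>, the last of an \<open>(n + 1)\<close>-tuple.\<close>
  define N where "N = max n (Suc i)"
  define g where "g j = (if j = i then n else if j < n then j else n)" for j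
  define R where "R = {xs \<in> tuples N D. sat A V (nth xs) \<phi>}"
  define S where "S = {xs \<in> tuples (Suc n) D. map (nth xs) (map g [0..<N]) \<in> R}"
  have "R \<in> X"
    unfolding R_def using FAll.prems by (intro FAll.IH) (auto simp: N_def)
  then have "S \<in> X"
    unfolding S_def by (rule reindex) (auto simp: g_def)
  then have *: "{xs \<in> tuples n D. \<forall>x\<in>D. xs @ [x] \<in> S} \<in> X"
    by (rule all)
  have "xs @ [x] \<in> S \<longleftrightarrow> sat A V ((nth xs)(i := x)) \<phi>" if "xs \<in> tuples n D" "x \<in> D" for xs x
  proof -
    let ?ys = "map (nth (xs @ [x])) (map g [0..<N])"
    have len: "length xs = n" using that by (simp add: tuples_def)
    have mem: "?ys \<in> tuples N D"
      using that len by (auto simp: tuples_def g_def nth_append)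
    have "sat A V (nth ?ys) \<phi> \<longleftrightarrow> sat A V ((nth xs)(i := x)) \<phi>"
    proof (rule sat_cong)
      fix j assume "j \<in> fv \<phi>"
      then have "j < N" "j = i \<or> j < n"
        using FAll.prems(3) by (auto simp: N_def less_max_iff_disj)
      then show "?ys ! j = ((nth xs)(i := x)) j"
        using len by (auto simp: g_def nth_append)
    qed simp
    moreover have "xs @ [x] \<in> tuples (Suc n) D" using that by (auto simp: tuples_def)
    ultimately show ?thesis using mem by (simp add: S_def R_def)
  qed
  then have "{xs \<in> tuples n D. \<forall>x\<in>D. xs @ [x] \<in> S} = {xs \<in> tuples n D. sat A V (nth xs) (FAll i \<phi>)}"
    using assms(1) by auto
  with * show ?case by simp
qed

text \<open>Quantifiers over elements of multidimensional structures are blocks of quantifiers. The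
  arity \<open>n\<close> varies in the induction: once one coordinate is fixed, the remaining
  \<open>k\<close> are quantified in arity \<open>Suc n\<close>.\<close>

lemma all_block:
  "R \<in> X \<Longrightarrow> {xs \<in> tuples n D. \<forall>ys\<in>tuples k D. xs @ ys \<in> R} \<in> X"
proof (induction k arbitrary: n)
  case 0
  \<comment> \<open>Reindexing along the identity only restricts \<open>R\<close> to words of length
    \<open>n\<close>, as \<open>R\<close> may have another arity.\<close>
  have "{xs \<in> tuples n D. map (nth xs) [0..<n] \<in> R} \<in> X"
    using 0 by (intro reindex) auto
  moreover have "map (nth xs) [0..<n] = xs" if "xs \<in> tuples n D" for xs
    using that by (auto simp: tuples_def map_nth)
  ultimately show ?case by (simp cong: conj_cong)
next
  case (Suc k)
  let ?S = "{xs \<in> tuples (Suc n) D. \<forall>ys\<in>tuples k D. xs @ ys \<in> R}"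
  have "{xs \<in> tuples n D. \<forall>x\<in>D. xs @ [x] \<in> ?S} \<in> X"
    using Suc by (intro all) blast
  moreover have "(\<forall>x\<in>D. xs @ [x] \<in> ?S) \<longleftrightarrow> (\<forall>ys\<in>tuples (Suc k) D. xs @ ys \<in> R)"
    if "xs \<in> tuples n D" for xs
  proof -
    have "xs @ [x] \<in> tuples (Suc n) D" if "x \<in> D" for x
      using that \<open>xs \<in> tuples n D\<close> by (auto simp: tuples_def)
    moreover have "tuples (Suc k) D = {x # ys | x ys. x \<in> D \<and> ys \<in> tuples k D}"
      by (auto simp: tuples_def length_Suc_conv)
    ultimately show ?thesis by auto
  qed
  ultimately show ?case by (simp cong: conj_cong)
qed

lemma ex_block:
  assumes "R \<in> X"
  shows "{xs \<in> tuples n D. \<exists>ys\<in>tuples k D. xs @ ys \<in> R} \<in> X"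
proof -
  \<comment> \<open>The complement has to be taken in arity \<open>n + k\<close>, where
    \<open>xs @ ys\<close> lives.\<close>
  let ?R = "{xs \<in> tuples (n + k) D. xs \<notin> R}"
  have "{xs \<in> tuples n D. xs \<notin> {xs \<in> tuples n D. \<forall>ys\<in>tuples k D. xs @ ys \<in> ?R}} \<in> X"
    using assms by (intro diff all_block)
  then show ?thesis
    by (rule back_subst[of "\<lambda>S. S \<in> X"]) (auto simp: tuples_def)
qed

text \<open>The projection of \<open>R\<close> to arity 0 is a truth value: either it is
  \<open>{[]}\<close>, or it is empty and its complement in arity 0 is \<open>{[]}\<close>. Some
  \<open>R\<close> must be given, since the locale does not make \<open>X\<close> inhabited.\<close>

lemma nil_mem:
  assumes "R \<in> X"
  shows "{[]} \<in> X"
proof -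
  obtain n where R: "R \<subseteq> tuples n D" using mem_tuples assms by blast
  have "{xs \<in> tuples 0 D. \<exists>ys\<in>tuples n D. xs @ ys \<in> R} \<in> X"
    using assms by (intro ex_block)
  moreover have "{xs \<in> tuples 0 D. xs \<notin> {xs \<in> tuples 0 D. \<exists>ys\<in>tuples n D. xs @ ys \<in> R}} \<in> X"
    using assms by (intro diff ex_block)
  ultimately show ?thesis
    by (cases "\<exists>ys\<in>tuples n D. ys \<in> R") (auto cong: conj_cong)
qed

text \<open>A product is the intersection of two cylinders, each a reindexing of one factor.\<close>

lemma append_mem:
  assumes "P \<in> X" "Q \<in> X" "P \<subseteq> tuples n D" "Q \<subseteq> tuples m D"
  shows "{p @ q | p q. p \<in> P \<and> q \<in> Q} \<in> X"
proof -
  have "{xs \<in> tuples (n + m) D. map (nth xs) [0..<n] \<in> P} \<inter>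
      {xs \<in> tuples (n + m) D. map (nth xs) [n..<n + m] \<in> Q} \<in> X"
    using assms by (intro inter reindex) auto
  moreover have "map (nth (p @ q)) [0..<n] = p" "map (nth (p @ q)) [n..<n + m] = q"
    if "p \<in> tuples n D" "q \<in> tuples m D" for p q
    using that by (auto simp: tuples_def intro: map_nth_append_left map_nth_append_right)
  ultimately show ?thesis
    using assms(3,4)
    by (elim back_subst[of "\<lambda>S. S \<in> X"])
      (use assms(3,4) in \<open>fastforce elim!: tuples_appendE simp: tuples_appendI subset_iff\<close>)
qed

end

text \<open>Each closure property is comprehension for one formula built from predicate variables,
  with the given members of \<open>X\<close> as second-order parameters.\<close>

lemma standalone_comprehension_definable_family:
  assumes "standalone_comprehension L M X" "\<forall>R\<in>X. \<exists>n. R \<subseteq> tuples n (Dom M)"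
  shows "definable_family (Dom M) X"
proof -
  have compr: "{xs \<in> tuples n (Dom M). sat M V (nth xs) \<phi>} \<in> X"
    if "lang \<phi> = {}" "\<And>p k. (p, k) \<in> pvars \<phi> \<Longrightarrow> V p \<in> X" "fv \<phi> \<subseteq> {..<n}" for \<phi> n V
    using assms(1) that unfolding standalone_comprehension_def by blast
  have tup: "map (nth xs) [0..<n] = xs" if "xs \<in> tuples n (Dom M)" for xs n
    using that by (auto simp: tuples_def map_nth)
  have diff: "{xs \<in> tuples n (Dom M). xs \<notin> R} \<in> X" if "R \<in> X" for R n
    using compr[of "FNeg (FPred 0 [0..<n])" "\<lambda>_. R" n] that by (auto simp: tup lessThan_atLeast0 cong: conj_cong)
  show ?thesis
  proof
    fix R S assume RS: "R \<in> X" "S \<in> X"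
    then have if_mem: "(if p = 0 then R else S) \<in> X" for p :: nat by simp
    obtain n where n: "R \<subseteq> tuples n (Dom M)" using assms(2) RS by blast
    have "{xs \<in> tuples n (Dom M). xs \<in> R \<and> xs \<in> S} \<in> X"
      using compr[of "FConj (FPred 0 [0..<n]) (FPred 1 [0..<n])" "\<lambda>p. if p = 0 then R else S" n,
          OF _ if_mem] RS by (simp add: tup lessThan_atLeast0 cong: conj_cong)
    then show "R \<inter> S \<in> X"
      by (rule back_subst[of "\<lambda>S. S \<in> X"]) (use n in auto)
  next
    fix R n and g :: "nat list" assume "R \<in> X" "set g \<subseteq> {..<n}"
    then show "{xs \<in> tuples n (Dom M). map (nth xs) g \<in> R} \<in> X"
      using compr[of "FPred 0 g" "\<lambda>_. R" n] by auto
  next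
    fix R n assume "R \<in> X"
    then have "{xs \<in> tuples n (Dom M). sat M (\<lambda>_. R) (nth xs) (FAll n (FPred 0 [0..<Suc n]))} \<in> X"
      by (intro compr) auto
    moreover have "map ((nth xs)(n := x)) [0..<Suc n] = xs @ [x]" if "xs \<in> tuples n (Dom M)" for xs x
      using tup[OF that] by simp
    ultimately show "{xs \<in> tuples n (Dom M). \<forall>x\<in>Dom M. xs @ [x] \<in> R} \<in> X"
      by (simp del: upt_Suc cong: conj_cong)
  qed (use assms diff in auto)
qed

section \<open>Relations on tuples of fixed length, coded by flattening\<close>

lemma concat_tuples:
  assumes "\<forall>x\<in>E. length x = d" "xs \<in> tuples n E"
  shows "length (concat xs) = n * d"
proof -
  have "length (concat xs) = sum_list (map (\<lambda>_. d) xs)"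
    unfolding length_concat using assms by (intro arg_cong[where f = sum_list] map_cong) (auto simp: tuples_def)
  then show ?thesis using assms by (simp add: sum_list_triv tuples_def)
qed

text \<open>A positive block length lets the length of the word determine the number of blocks. For
  \<open>d = 0\<close> every list over \<open>E\<close> would flatten to the empty list.\<close>

lemma inj_on_concat:
  assumes "\<forall>x\<in>E. length x = d" "d > 0"
  shows "inj_on concat (lists E)"
proof (rule inj_onI)
  fix xs ys assume *: "xs \<in> lists E" "ys \<in> lists E" "concat xs = concat ys"
  then have "xs \<in> tuples (length xs) E" "ys \<in> tuples (length ys) E"
    by (auto simp: tuples_def)
  then have "length xs * d = length ys * d"
    using concat_tuples[OF assms(1)] * by metis
  moreover have "0 < d" by fact
  ultimately have "length xs = length ys" by simp
  moreover have "length a = length b" if "(a, b) \<in> set (zip xs ys)" for a b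
    using assms(1) * set_zip_leftD[OF that] set_zip_rightD[OF that] by (simp add: in_lists_conv_set)
  ultimately show "xs = ys"
    using * by (intro concat_injective) auto
qed

lemma map_nth_concat:
  "\<forall>x\<in>set xs. length x = d \<Longrightarrow> j < length xs \<Longrightarrow> map (nth (concat xs)) [j * d..<j * d + d] = xs ! j"
proof (induction xs arbitrary: j)
  case (Cons x xs)
  show ?case
  proof (cases j)
    case 0
    with Cons show ?thesis by (simp add: map_nth_append_left)
  next
    case (Suc i)
    have "map (nth (x @ concat xs)) [j * d..<j * d + d] = map (nth (concat xs)) [i * d..<i * d + d]"
      using Cons.prems Suc by (intro nth_equalityI) (auto simp: nth_append)
    then show ?thesis using Cons Suc by simp
  qed
qed simp

text \<open>This is the coding by which \<open>strong_model\<close> speaks of predicates on a model;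
  compatibility with the equality is imposed separately.\<close>

definition block_family :: "'b list set \<Rightarrow> 'b list set set \<Rightarrow> 'b list list set set" where
  "block_family E X = {R. \<exists>k. R \<subseteq> tuples k E \<and> concat ` R \<in> X}"

text \<open>Needed for relativisation: complements and quantifiers over \<open>E\<close> must be cut
  down to words that split into blocks from \<open>E\<close>.\<close>

lemma (in definable_family) concat_tuples_mem:
  assumes "E \<in> X" "E \<subseteq> tuples d D"
  shows "concat ` tuples n E \<in> X"
proof (induction n)
  case 0
  show ?case using nil_mem[OF assms(1)] by simp
next
  case (Suc n)
  have "concat ` tuples n E \<subseteq> tuples (n * d) D"
    using assms(2) concat_tuples[of E d _ n] by (fastforce simp: tuples_def)
  then have "{p @ q | p q. p \<in> E \<and> q \<in> concat ` tuples n E} \<in> X"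
    using assms Suc by (intro append_mem)
  moreover have "concat ` tuples (Suc n) E = {p @ q | p q. p \<in> E \<and> q \<in> concat ` tuples n E}"
    (is "?l = ?r")
  proof (intro equalityI subsetI)
    fix w assume "w \<in> ?l"
    then obtain x xs where "w = x @ concat xs" "x \<in> E" "xs \<in> tuples n E"
      by (auto simp: tuples_def length_Suc_conv)
    then show "w \<in> ?r" by blast
  next
    fix w assume "w \<in> ?r"
    then obtain x xs where "w = concat (x # xs)" "x # xs \<in> tuples (Suc n) E"
      by (auto simp: tuples_def)
    then show "w \<in> ?l" by blast
  qed
  ultimately show ?case by simp
qed

context definable_family
begin

lemma relcomp_mem:
  assumes "P \<in> X" "Q \<in> X"
  shows "{a @ c | a c. a \<in> tuples i D \<and> c \<in> tuples j D \<and> (\<exists>b\<in>tuples k D. a @ b \<in> P \<and> b @ c \<in> Q)} \<in> X"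
proof -
  \<comment> \<open>The word is arranged as \<open>a\<close>, \<open>c\<close>, \<open>b\<close>,
    with the middle term \<open>b\<close> last, since \<open>ex_block\<close> quantifies final
    coordinates only.\<close>
  let ?P = "{w \<in> tuples (i + j + k) D. map (nth w) ([0..<i] @ [i + j..<i + j + k]) \<in> P}"
  let ?Q = "{w \<in> tuples (i + j + k) D. map (nth w) ([i + j..<i + j + k] @ [i..<i + j]) \<in> Q}"
  have *: "{w \<in> tuples (i + j) D. \<exists>b\<in>tuples k D. w @ b \<in> ?P \<inter> ?Q} \<in> X"
    using assms by (intro ex_block inter reindex) auto
  have "(a @ c) @ b \<in> ?P \<inter> ?Q \<longleftrightarrow> a @ b \<in> P \<and> b @ c \<in> Q"
    if "a \<in> tuples i D" "c \<in> tuples j D" "b \<in> tuples k D" for a b c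
  proof -
    have "length a = i" "length c = j" "length b = k" using that by (auto simp: tuples_def)
    then have "map (nth ((a @ c) @ b)) [0..<i] = a" "map (nth ((a @ c) @ b)) [i..<i + j] = c"
      "map (nth ((a @ c) @ b)) [i + j..<i + j + k] = b"
      using map_nth_append_left[of a i "c @ b"] map_nth_append_mid[of a i c j b]
        map_nth_append_right[of "a @ c" "i + j" b k] by simp_all
    moreover have "(a @ c) @ b \<in> tuples (i + j + k) D"
      using that by (intro tuples_appendI)
    ultimately show ?thesis by simp
  qed
  then have "{w \<in> tuples (i + j) D. \<exists>b\<in>tuples k D. w @ b \<in> ?P \<inter> ?Q} =
      {a @ c | a c. a \<in> tuples i D \<and> c \<in> tuples j D \<and> (\<exists>b\<in>tuples k D. a @ b \<in> P \<and> b @ c \<in> Q)}"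
    by (blast elim: tuples_appendE intro: tuples_appendI)
  with * show ?thesis by simp
qed

lemma converse_mem:
  assumes "P \<in> X"
  shows "{c @ a | a c. a \<in> tuples i D \<and> c \<in> tuples j D \<and> a @ c \<in> P} \<in> X"
proof -
  let ?S = "{w \<in> tuples (j + i) D. map (nth w) ([j..<j + i] @ [0..<j]) \<in> P}"
  have *: "?S \<in> X" using assms by (intro reindex) auto
  have "c @ a \<in> ?S \<longleftrightarrow> a @ c \<in> P" if "a \<in> tuples i D" "c \<in> tuples j D" for a c
    using that map_nth_append_left[of c j a] map_nth_append_right[of c j a i] tuples_appendI[of c j D a i]
    by (simp add: tuples_def)
  then have "?S = {c @ a | a c. a \<in> tuples i D \<and> c \<in> tuples j D \<and> a @ c \<in> P}"
    by (blast elim: tuples_appendE)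
  with * show ?thesis by simp
qed

text \<open>A map between models acts componentwise on tuples of elements. For fixed
  \<open>m\<close> this action, flattened, is first-order over \<open>G\<close>: one pair is added
  at a time.\<close>

lemma listrel_mem:
  assumes "{a @ b | a b. (a, b) \<in> G} \<in> X" "G \<subseteq> tuples p D \<times> tuples q D"
  shows "{concat u @ concat v | u v. length u = m \<and> list_all2 (\<lambda>a b. (a, b) \<in> G) u v} \<in> X"
proof (induction m)
  case 0
  have "{concat u @ concat v | u v. length u = 0 \<and> list_all2 (\<lambda>a b. (a, b) \<in> G) u v} = {[]}" by auto
  with nil_mem[OF assms(1)] show ?case by simp
next
  case (Suc m)
  let ?G = "{a @ b | a b. (a, b) \<in> G}"
  let ?H = "{concat u @ concat v | u v. length u = m \<and> list_all2 (\<lambda>a b. (a, b) \<in> G) u v}"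
  \<comment> \<open>A word of this length has the form \<open>a @ w @ b @ z\<close>: head and
    flattened tail of the left list, then head and flattened tail of the right one.
    \<open>?P\<close> extracts the heads, \<open>?Q\<close> the tails.\<close>
  let ?n = "p + m * p + q + m * q"
  let ?P = "{w \<in> tuples ?n D. map (nth w) ([0..<p] @ [p + m * p..<p + m * p + q]) \<in> ?G}"
  let ?Q = "{w \<in> tuples ?n D. map (nth w) ([p..<p + m * p] @ [p + m * p + q..<?n]) \<in> ?H}"
  have *: "?P \<inter> ?Q \<in> X"
    using assms Suc by (intro inter reindex) auto
  have iff: "a @ w @ b @ z \<in> ?P \<inter> ?Q \<longleftrightarrow> a @ b \<in> ?G \<and> w @ z \<in> ?H"
    if "a \<in> tuples p D" "b \<in> tuples q D" "w \<in> tuples (m * p) D" "z \<in> tuples (m * q) D" for a b w z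
  proof -
    have len: "length a = p" "length b = q" "length w = m * p" "length z = m * q"
      using that by (auto simp: tuples_def)
    let ?s = "a @ w @ b @ z"
    have "map (nth ?s) [0..<p] = a" "map (nth ?s) [p..<p + m * p] = w"
      "map (nth ?s) [p + m * p..<p + m * p + q] = b" "map (nth ?s) [p + m * p + q..<?n] = z"
      using len map_nth_append_left[of a p "w @ b @ z"] map_nth_append_mid[of a p w "m * p" "b @ z"]
        map_nth_append_mid[of "a @ w" "p + m * p" b q z]
        map_nth_append_right[of "a @ w @ b" "p + m * p + q" z "m * q"] by simp_all
    moreover have "?s \<in> tuples ?n D"
      using tuples_appendI[OF tuples_appendI[OF tuples_appendI[OF that(1,3)] that(2)] that(4)] by simp
    ultimately show ?thesis by simp
  qed
  have G: "list_all2 (\<lambda>a b. (a, b) \<in> G) u v \<Longrightarrow> length u = m \<Longrightarrow>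
    concat u \<in> tuples (m * p) D \<and> concat v \<in> tuples (m * q) D" for u v
  proof (induction u v arbitrary: m rule: list_all2_induct)
    case (Cons a u b v)
    then show ?case using assms(2) by (auto simp: tuples_def)
  qed simp
  have "?P \<inter> ?Q = {concat u @ concat v | u v. length u = Suc m \<and> list_all2 (\<lambda>a b. (a, b) \<in> G) u v}"
    (is "?l = ?r")
  proof (intro equalityI subsetI)
    fix s assume s: "s \<in> ?l"
    then have "s \<in> tuples ?n D" by blast
    then obtain a w b z where sz: "s = a @ w @ b @ z" "a \<in> tuples p D" "b \<in> tuples q D"
      "w \<in> tuples (m * p) D" "z \<in> tuples (m * q) D"
      by (elim tuples_appendE) auto
    then have "a @ b \<in> ?G" "w @ z \<in> ?H" using s iff[OF sz(2-5)] by blast+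
    then obtain a' b' u v where *: "a @ b = a' @ b'" "(a', b') \<in> G" "w @ z = concat u @ concat v"
      "length u = m" "list_all2 (\<lambda>a b. (a, b) \<in> G) u v"
      by blast
    moreover have "a' \<in> tuples p D" "concat u \<in> tuples (m * p) D"
      using *(2) assms(2) G[OF *(5,4)] by auto
    then have "length a = length a'" "length w = length (concat u)"
      using sz(2,4) by (simp_all add: tuples_def)
    ultimately have "a = a'" "b = b'" "w = concat u" "z = concat v"
      by (meson append_eq_append_conv)+
    then have "s = concat (a' # u) @ concat (b' # v)" using sz(1) by simp
    moreover have "length (a' # u) = Suc m" "list_all2 (\<lambda>a b. (a, b) \<in> G) (a' # u) (b' # v)"
      using * by simp_all
    ultimately show "s \<in> ?r" by blast
  next
    fix s assume "s \<in> ?r"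
    then obtain a b u v where *: "s = a @ concat u @ b @ concat v" "(a, b) \<in> G"
      "length u = m" "list_all2 (\<lambda>a b. (a, b) \<in> G) u v"
      by (auto simp: length_Suc_conv list_all2_Cons1)
    then have "a \<in> tuples p D" "b \<in> tuples q D" using assms(2) by auto
    with iff[of a b "concat u" "concat v"] G[of u v] * show "s \<in> ?l" by blast
  qed
  with * show ?case by simp
qed

text \<open>One variable over \<open>E\<close> becomes \<open>d\<close> variables over
  \<open>D\<close>, with complements and quantifiers relativised to \<open>E\<close>. With
  \<open>E\<close> the domain of a strong model, \<open>definable_sat\<close> becomes applicable
  inside that model.\<close>

lemma block_family:
  assumes E: "E \<in> X" "E \<subseteq> tuples d D" and "d > 0"
  shows "definable_family E (block_family E X)"
proof -
  have inj: "inj_on concat (lists E)"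
    using assms by (intro inj_on_concat[of _ d]) (auto simp: tuples_def)
  have len: "concat xs \<in> tuples (n * d) D" if "xs \<in> tuples n E" for xs n
    using E(2) that concat_tuples[of E d xs n] by (auto simp: tuples_def)
  have mem: "concat xs \<in> concat ` R \<longleftrightarrow> xs \<in> R" if "xs \<in> tuples n E" "R \<in> block_family E X" for xs n R
    using that inj_on_image_mem_iff[OF inj, of xs R] by (auto simp: block_family_def tuples_def)
  \<comment> \<open>Common pattern of several cases below: describe the flattened relation among all
    words of length \<open>n * d\<close>, then cut down to words composed of blocks from
    \<open>E\<close>.\<close>
  have mem_family: "{xs \<in> tuples n E. P xs} \<in> block_family E X"
    if "{w \<in> tuples (n * d) D. Q w} \<in> X" "\<And>xs. xs \<in> tuples n E \<Longrightarrow> P xs \<longleftrightarrow> Q (concat xs)" for n P Q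
  proof -
    have "concat ` {xs \<in> tuples n E. P xs} = concat ` tuples n E \<inter> {w \<in> tuples (n * d) D. Q w}"
      using that(2) len by blast
    moreover have "\<dots> \<in> X"
      using that E by (intro inter concat_tuples_mem)
    ultimately show ?thesis by (auto simp: block_family_def)
  qed
  show ?thesis
  proof
    fix R assume "R \<in> block_family E X"
    then show "\<exists>n. R \<subseteq> tuples n E" by (auto simp: block_family_def)
  next
    fix R n assume R: "R \<in> block_family E X"
    then have "{w \<in> tuples (n * d) D. w \<notin> concat ` R} \<in> X"
      by (intro diff) (auto simp: block_family_def)
    then show "{xs \<in> tuples n E. xs \<notin> R} \<in> block_family E X"
      by (rule mem_family) (simp add: mem[OF _ R])
  next
    fix R S assume RS: "R \<in> block_family E X" "S \<in> block_family E X"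
    then obtain n k where "R \<subseteq> tuples n E" "S \<subseteq> tuples k E" by (auto simp: block_family_def)
    then have "concat ` (R \<inter> S) = concat ` R \<inter> concat ` S"
      using tuples_lists by (intro inj_on_image_Int[OF inj]) blast+
    moreover have "concat ` R \<inter> concat ` S \<in> X"
      using RS by (intro inter) (auto simp: block_family_def)
    ultimately show "R \<inter> S \<in> block_family E X"
      using \<open>R \<subseteq> tuples n E\<close> by (auto simp: block_family_def)
  next
    fix R n and g :: "nat list" assume R: "R \<in> block_family E X" and g: "set g \<subseteq> {..<n}"
    \<comment> \<open>The index list \<open>g\<close> on blocks, expanded to positions in the
      flattened word.\<close>
    let ?g = "concat (map (\<lambda>j. [j * d..<j * d + d]) g)"
    have bound: "j * d + i < n * d" if "j < n" "i < d" for i j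
    proof -
      have "j * d + i < Suc j * d" using that by simp
      also have "\<dots> \<le> n * d" using that by (intro mult_le_mono1) simp
      finally show ?thesis .
    qed
    have "k < n * d" if k: "k \<in> set ?g" for k
    proof -
      obtain j where "j \<in> set g" "j * d \<le> k" "k < j * d + d" using k by auto
      then show ?thesis using bound[of j "k - j * d"] g by auto
    qed
    then have "{w \<in> tuples (n * d) D. map (nth w) ?g \<in> concat ` R} \<in> X"
      using R by (intro reindex) (auto simp: block_family_def simp del: set_concat)
    then show "{xs \<in> tuples n E. map (nth xs) g \<in> R} \<in> block_family E X"
    proof (rule mem_family)
      fix xs assume xs: "xs \<in> tuples n E"
      have "map (nth (concat xs)) [j * d..<j * d + d] = xs ! j" if "j \<in> set g" for j
        using that xs g E(2) by (intro map_nth_concat) (auto simp: tuples_def)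
      then have "map (nth (concat xs)) ?g = concat (map (nth xs) g)"
        by (simp add: map_concat comp_def cong: map_cong)
      moreover have "map (nth xs) g \<in> tuples (length g) E"
        using xs g by (fastforce simp: tuples_def intro: nth_mem)
      ultimately show "map (nth xs) g \<in> R \<longleftrightarrow> map (nth (concat xs)) ?g \<in> concat ` R"
        by (simp add: mem[OF _ R])
    qed
  next
    fix R n assume R: "R \<in> block_family E X"
    \<comment> \<open>Written with complements and an intersection, this is an implication: if the
      word splits into \<open>n + 1\<close> blocks from \<open>E\<close>, then it belongs to the
      flattened \<open>R\<close>. Quantifying over all \<open>d\<close>-tuples thus amounts to
      quantifying over \<open>E\<close>.\<close>
    let ?S = "{w \<in> tuples (n * d + d) D. w \<notin> {w \<in> tuples (n * d + d) D. w \<notin> concat ` R} \<inter> concat ` tuples (Suc n) E}"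
    have "{w \<in> tuples (n * d) D. \<forall>x\<in>tuples d D. w @ x \<in> ?S} \<in> X"
      using R E by (intro all_block diff inter concat_tuples_mem) (auto simp: block_family_def)
    then show "{xs \<in> tuples n E. \<forall>x\<in>E. xs @ [x] \<in> R} \<in> block_family E X"
    proof (rule mem_family)
      fix xs assume xs: "xs \<in> tuples n E"
      have 1: "concat xs @ x \<in> ?S \<longleftrightarrow> xs @ [x] \<in> R" if "x \<in> E" for x
      proof -
        have *: "xs @ [x] \<in> tuples (Suc n) E" using xs that by (auto simp: tuples_def)
        then have "concat xs @ x \<in> concat ` tuples (Suc n) E" by (intro image_eqI[of _ _ "xs @ [x]"]) auto
        moreover have "concat xs @ x \<in> tuples (n * d + d) D" using len[OF *] by (simp add: add.commute)
        ultimately show ?thesis using mem[OF * R] by simp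
      qed
      have 2: "concat xs @ x \<in> ?S" if "x \<in> tuples d D" "x \<notin> E" for x
      proof -
        have "concat xs @ x \<notin> concat ` tuples (Suc n) E"
        proof
          assume "concat xs @ x \<in> concat ` tuples (Suc n) E"
          then obtain ys where ys: "concat xs @ x = concat ys" "ys \<in> tuples (n + 1) E" by auto
          from ys(2) obtain zs y where y: "ys = zs @ [y]" "zs \<in> tuples n E" "y \<in> E"
            by (elim tuples_appendE) (auto simp: tuples_def length_Suc_conv)
          from ys(1) y(1) have "concat xs @ x = concat zs @ y" by simp
          moreover from that(1) y(3) E(2) have "length x = length y"
            by (auto simp: tuples_def subset_iff)
          ultimately have "x = y" by (meson append_eq_append_conv)
          with y that show False by simp
        qed
        moreover have "concat xs @ x \<in> tuples (n * d + d) D"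
          using len[OF xs] that by (intro tuples_appendI)
        ultimately show ?thesis by blast
      qed
      show "(\<forall>x\<in>E. xs @ [x] \<in> R) \<longleftrightarrow> (\<forall>x\<in>tuples d D. concat xs @ x \<in> ?S)"
        using 1 2 E(2) by blast
    qed
  qed
qed

end

text \<open>Iterates one injection of pairs into the type, which exists by infinity. It turns
  elements of a \<open>d\<close>-dimensional model into points of the universe.\<close>

lemma ex_inj_on_lists:
  assumes "infinite (UNIV :: 'a set)"
  shows "\<exists>f :: 'a list \<Rightarrow> 'a. inj_on f {xs. length xs = n}"
proof -
  obtain p :: "'a \<times> 'a \<Rightarrow> 'a" where p: "inj p"
    using card_of_Times_same_infinite[OF assms] by (auto simp: ordIso_iff_ordLeq card_of_ordLeq[symmetric])
  show ?thesis
  proof (induction n)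
    case 0
    have "inj_on f {xs :: 'a list. length xs = 0}" for f :: "'a list \<Rightarrow> 'a" by (simp add: inj_on_def)
    then show ?case by blast
  next
    case (Suc n)
    then obtain f :: "'a list \<Rightarrow> 'a" where f: "inj_on f {xs. length xs = n}" by blast
    have "inj_on (\<lambda>xs. p (hd xs, f (tl xs))) {xs. length xs = Suc n}"
      using f by (auto simp: inj_on_def length_Suc_conv inj_eq[OF p])
    then show ?case by blast
  qed
qed

section \<open>Isomorphisms\<close>

lemma holds_iff_sat: "fv \<phi> = {} \<Longrightarrow> holds A V \<phi> \<longleftrightarrow> sat A V s \<phi>"
  unfolding holds_def using sat_cong[of \<phi> _ s V V A] by blast

lemma is_isoD:
  assumes "is_iso L A B F"
  shows is_iso_dom: "(a, b) \<in> F \<Longrightarrow> a \<in> Dom A \<and> b \<in> Dom B"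
    and is_iso_total: "a \<in> Dom A \<Longrightarrow> \<exists>b\<in>Dom B. (a, b) \<in> F"
    and is_iso_surj: "b \<in> Dom B \<Longrightarrow> \<exists>a\<in>Dom A. (a, b) \<in> F"
    and is_iso_eq: "(a, b) \<in> F \<Longrightarrow> (a', b') \<in> F \<Longrightarrow> (a, a') \<in> Eqv A \<longleftrightarrow> (b, b') \<in> Eqv B"
    and is_iso_rel: "(r, length xs) \<in> L \<Longrightarrow> list_all2 (\<lambda>a b. (a, b) \<in> F) xs ys \<Longrightarrow>
      xs \<in> Rl A r (length xs) \<longleftrightarrow> ys \<in> Rl B r (length xs)"
  using assms unfolding is_iso_def by blast+

lemma is_isoI:
  assumes "\<And>a b. (a, b) \<in> F \<Longrightarrow> a \<in> Dom A \<and> b \<in> Dom B"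
    and "\<And>a. a \<in> Dom A \<Longrightarrow> \<exists>b. (a, b) \<in> F" "\<And>b. b \<in> Dom B \<Longrightarrow> \<exists>a. (a, b) \<in> F"
    and "\<And>a b a' b'. (a, b) \<in> F \<Longrightarrow> (a', b') \<in> F \<Longrightarrow> (a, a') \<in> Eqv A \<longleftrightarrow> (b, b') \<in> Eqv B"
    and "\<And>r xs ys. (r, length xs) \<in> L \<Longrightarrow> list_all2 (\<lambda>a b. (a, b) \<in> F) xs ys \<Longrightarrow>
      xs \<in> Rl A r (length xs) \<longleftrightarrow> ys \<in> Rl B r (length xs)"
  shows "is_iso L A B F"
  unfolding is_iso_def
proof (intro conjI)
  show "F \<subseteq> Dom A \<times> Dom B" "\<forall>a\<in>Dom A. \<exists>b. (a, b) \<in> F" "\<forall>b\<in>Dom B. \<exists>a. (a, b) \<in> F"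
    using assms(1-3) by auto
  show "\<forall>(a, b)\<in>F. \<forall>(a', b')\<in>F. (a, a') \<in> Eqv A \<longleftrightarrow> (b, b') \<in> Eqv B"
    using assms(4) by blast
  show "\<forall>(r, n)\<in>L. \<forall>xs ys. length xs = n \<and> list_all2 (\<lambda>a b. (a, b) \<in> F) xs ys \<longrightarrow>
      (xs \<in> Rl A r n \<longleftrightarrow> ys \<in> Rl B r n)"
    using assms(5) by blast
qed

text \<open>\<open>F\<close> is a correspondence, not a function. Quantifiers only need it to be
  total on both sides, and atoms only need it to preserve and reflect equality and relations; the
  last assumption treats predicate variables like further relations.\<close>

lemma iso_sat:
  assumes iso: "is_iso L A B F" and "lang \<phi> \<subseteq> L" "\<And>i. i \<in> fv \<phi> \<Longrightarrow> (s i, s' i) \<in> F"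
    and "\<And>p xs ys. (p, length xs) \<in> pvars \<phi> \<Longrightarrow> list_all2 (\<lambda>a b. (a, b) \<in> F) xs ys \<Longrightarrow>
      xs \<in> V p \<longleftrightarrow> ys \<in> W p"
  shows "sat A V s \<phi> \<longleftrightarrow> sat B W s' \<phi>"
  using assms(2-)
proof (induction \<phi> arbitrary: s s')
  case (FEq i j)
  then have "(s i, s' i) \<in> F" "(s j, s' j) \<in> F" by auto
  then show ?case using is_iso_eq[OF iso] by simp
next
  case (FRel r xs)
  then have "list_all2 (\<lambda>a b. (a, b) \<in> F) (map s xs) (map s' xs)" "(r, length xs) \<in> L"
    by (auto simp: list_all2_conv_all_nth)
  then show ?case using is_iso_rel[OF iso, of r "map s xs" "map s' xs"] by simp
next
  case (FPred p xs)
  then have "list_all2 (\<lambda>a b. (a, b) \<in> F) (map s xs) (map s' xs)"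
    by (auto simp: list_all2_conv_all_nth)
  then show ?case using FPred.prems(3)[of p "map s xs" "map s' xs"] by simp
next
  case (FNeg \<phi>)
  have "sat A V s \<phi> \<longleftrightarrow> sat B W s' \<phi>"
    by (rule FNeg.IH) (use FNeg.prems in auto)
  then show ?case by simp
next
  case (FConj \<phi> \<psi>)
  have "sat A V s \<phi> \<longleftrightarrow> sat B W s' \<phi>"
    by (intro FConj.IH(1) FConj.prems(2,3)) (use FConj.prems(1) in auto)
  moreover have "sat A V s \<psi> \<longleftrightarrow> sat B W s' \<psi>"
    by (intro FConj.IH(2) FConj.prems(2,3)) (use FConj.prems(1) in auto)
  ultimately show ?case by simp
next
  case (FAll i \<phi>)
  have "sat A V (s(i := a)) \<phi> \<longleftrightarrow> sat B W (s'(i := b)) \<phi>" if "(a, b) \<in> F" for a b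
    by (rule FAll.IH) (use FAll.prems that in auto)
  moreover have "\<forall>a\<in>Dom A. \<exists>b\<in>Dom B. (a, b) \<in> F" "\<forall>b\<in>Dom B. \<exists>a\<in>Dom A. (a, b) \<in> F"
    using is_iso_total[OF iso] is_iso_surj[OF iso] by blast+
  ultimately show ?case by (simp, blast)
qed

lemma iso_holds:
  assumes "is_iso L A B F" "lang \<phi> \<subseteq> L" "fv \<phi> = {}"
    and "\<And>p xs ys. (p, length xs) \<in> pvars \<phi> \<Longrightarrow> list_all2 (\<lambda>a b. (a, b) \<in> F) xs ys \<Longrightarrow>
      xs \<in> V p \<longleftrightarrow> ys \<in> W p"
  shows "holds A V \<phi> \<longleftrightarrow> holds B W \<phi>"
proof -
  have "sat A V s \<phi> \<longleftrightarrow> sat B W s' \<phi>" for s s'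
    using assms by (intro iso_sat) auto
  then show ?thesis using holds_iff_sat[OF assms(3)] by metis
qed

lemma list_all2_converse: "list_all2 (\<lambda>a b. (b, a) \<in> F) xs ys \<longleftrightarrow> list_all2 (\<lambda>a b. (a, b) \<in> F) ys xs"
  by (auto simp: list_all2_conv_all_nth)

lemma list_all2_relcomp:
  "list_all2 (\<lambda>a b. (a, b) \<in> F O G) xs zs \<longleftrightarrow>
    (\<exists>ys. list_all2 (\<lambda>a b. (a, b) \<in> F) xs ys \<and> list_all2 (\<lambda>a b. (a, b) \<in> G) ys zs)"
proof -
  have "(\<lambda>a b. (a, b) \<in> F O G) = (\<lambda>a b. (a, b) \<in> F) OO (\<lambda>a b. (a, b) \<in> G)"
    by (auto simp: fun_eq_iff)
  then show ?thesis by (simp add: list.rel_compp relcompp_apply)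
qed

lemma is_iso_converse:
  assumes "is_iso L A B F"
  shows "is_iso L B A (F\<inverse>)"
proof (rule is_isoI)
  fix r ys xs assume "(r, length ys) \<in> L" and *: "list_all2 (\<lambda>a b. (a, b) \<in> F\<inverse>) ys xs"
  moreover from * have "length ys = length xs" by (rule list_all2_lengthD)
  ultimately show "ys \<in> Rl B r (length ys) \<longleftrightarrow> xs \<in> Rl A r (length ys)"
    using is_iso_rel[OF assms, of r xs ys] list_all2_converse[of F ys xs] by simp
qed (use is_isoD[OF assms] in blast)+

lemma is_iso_relcomp:
  assumes F: "is_iso L A B F" and G: "is_iso L B C G"
  shows "is_iso L A C (F O G)"
proof (rule is_isoI)
  fix a a' c c' assume "(a, c) \<in> F O G" "(a', c') \<in> F O G"
  then obtain b b' where "(a, b) \<in> F" "(b, c) \<in> G" "(a', b') \<in> F" "(b', c') \<in> G" by blast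
  then show "(a, a') \<in> Eqv A \<longleftrightarrow> (c, c') \<in> Eqv C"
    using is_iso_eq[OF F] is_iso_eq[OF G] by blast
next
  fix r xs zs assume L: "(r, length xs) \<in> L" and "list_all2 (\<lambda>a b. (a, b) \<in> F O G) xs zs"
  then obtain ys where ys: "list_all2 (\<lambda>a b. (a, b) \<in> F) xs ys" "list_all2 (\<lambda>a b. (a, b) \<in> G) ys zs"
    by (auto simp: list_all2_relcomp)
  moreover from ys(1) have "length ys = length xs" by (simp add: list_all2_lengthD)
  ultimately show "xs \<in> Rl A r (length xs) \<longleftrightarrow> zs \<in> Rl C r (length xs)"
    using is_iso_rel[OF F, of r xs ys] is_iso_rel[OF G, of r ys zs] L by simp
next
  fix a assume "a \<in> Dom A"
  then show "\<exists>c. (a, c) \<in> F O G" using is_iso_total[OF F] is_iso_total[OF G] by blast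
next
  fix c assume "c \<in> Dom C"
  then show "\<exists>a. (a, c) \<in> F O G" using is_iso_surj[OF F] is_iso_surj[OF G] by blast
qed (use is_iso_dom[OF F] is_iso_dom[OF G] in blast)

text \<open>Viewing the equality as an automorphism turns \<open>iso_sat\<close> into the invariance
  of satisfaction under replacement of equals.\<close>

lemma is_iso_Eqv:
  assumes "is_struct L A"
  shows "is_iso L A A (Eqv A)"
proof (rule is_isoI)
  have eq: "equiv (Dom A) (Eqv A)" using assms by (simp add: is_struct_def)
  show "a \<in> Dom A \<and> b \<in> Dom A" if "(a, b) \<in> Eqv A" for a b
    using that equiv_type[OF eq] by blast
  show "\<exists>b. (a, b) \<in> Eqv A" "\<exists>b. (b, a) \<in> Eqv A" if "a \<in> Dom A" for a
    using that equiv_class_self[OF eq] by blast+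
  show "(a, a') \<in> Eqv A \<longleftrightarrow> (b, b') \<in> Eqv A" if "(a, b) \<in> Eqv A" "(a', b') \<in> Eqv A" for a b a' b'
    using that eq by (meson equiv_def symD transD)
  show "xs \<in> Rl A r (length xs) \<longleftrightarrow> ys \<in> Rl A r (length xs)"
    if "(r, length xs) \<in> L" and xy: "list_all2 (\<lambda>a b. (a, b) \<in> Eqv A) xs ys" for r xs ys
  proof -
    have "list_all2 (\<lambda>a b. (a, b) \<in> Eqv A) ys xs"
      using xy eq by (auto simp: list_all2_conv_all_nth equiv_def dest: symD)
    moreover have "compat (Eqv A) (Rl A r (length xs))"
      using assms that(1) by (auto simp: is_struct_def)
    ultimately show ?thesis using xy unfolding compat_def by blast
  qed
qed

lemma interp_dom_iff:
  assumes "is_iso K A B F" "is_transl L K t" "list_all2 (\<lambda>a b. (a, b) \<in> F) u v"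
  shows "u \<in> interp_dom t A \<longleftrightarrow> v \<in> interp_dom t B"
proof (cases "length u = dim t")
  case True
  have "F \<subseteq> Dom A \<times> Dom B" using assms(1) by (simp add: is_iso_def)
  then have "set u \<subseteq> Dom A" "set v \<subseteq> Dom B"
    using assms(3) by (fastforce simp: list_all2_conv_all_nth in_set_conv_nth)+
  moreover have "sat A (\<lambda>_. {}) (nth u) (dom_fm t) \<longleftrightarrow> sat B (\<lambda>_. {}) (nth v) (dom_fm t)"
    using assms True by (intro iso_sat) (auto simp: is_transl_def fo_fm_def list_all2_conv_all_nth)
  ultimately show ?thesis
    using True assms(3) by (simp add: interp_dom_def tuples_def list_all2_lengthD)
next
  case False
  then show ?thesis using assms(3) by (simp add: interp_dom_def tuples_def list_all2_lengthD)
qed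

lemma list_all2_concat:
  "list_all2 (list_all2 P) us vs \<Longrightarrow> list_all2 P (concat us) (concat vs)"
  by (induction us vs rule: list_all2_induct) (auto intro: list_all2_appendI)

text \<open>The formulas of \<open>t\<close> are first-order without predicate variables, so
  \<open>iso_sat\<close> applies to each of them along the componentwise action of \<open>F\<close>.
  Only \<open>u\<close> is required to lie in the domain, as \<open>interp_dom_iff\<close> transfers
  this to \<open>v\<close>.\<close>

lemma is_iso_interp:
  assumes iso: "is_iso K A B F" and t: "is_transl L K t"
  shows "is_iso L (interp t A) (interp t B)
    {(u, v). u \<in> interp_dom t A \<and> list_all2 (\<lambda>a b. (a, b) \<in> F) u v}" (is "is_iso _ _ _ ?F")
proof (rule is_isoI)
  have dom: "v \<in> interp_dom t B" if "(u, v) \<in> ?F" for u v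
    using that interp_dom_iff[OF iso t] by blast
  have len: "length u = dim t" if "u \<in> interp_dom t A" for u
    using that by (simp add: interp_dom_def tuples_def)
  show "u \<in> Dom (interp t A) \<and> v \<in> Dom (interp t B)" if "(u, v) \<in> ?F" for u v
    using that dom by (auto simp: interp_def)
  show "\<exists>v. (u, v) \<in> ?F" if "u \<in> Dom (interp t A)" for u
  proof -
    have u: "u \<in> interp_dom t A" using that by (simp add: interp_def)
    then have "\<forall>a\<in>set u. \<exists>b. (a, b) \<in> F"
      using is_iso_total[OF iso] by (fastforce simp: interp_dom_def tuples_def)
    then obtain f where "\<forall>a\<in>set u. (a, f a) \<in> F" by metis
    then have "list_all2 (\<lambda>a b. (a, b) \<in> F) u (map f u)"
      by (simp add: list_all2_conv_all_nth)
    with u show ?thesis by blast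
  qed
  show "\<exists>u. (u, v) \<in> ?F" if "v \<in> Dom (interp t B)" for v
  proof -
    have v: "v \<in> interp_dom t B" using that by (simp add: interp_def)
    then have "\<forall>b\<in>set v. \<exists>a. (a, b) \<in> F"
      using is_iso_surj[OF iso] by (fastforce simp: interp_dom_def tuples_def)
    then obtain f where "\<forall>b\<in>set v. (f b, b) \<in> F" by metis
    then have "list_all2 (\<lambda>a b. (a, b) \<in> F) (map f v) v"
      by (simp add: list_all2_conv_all_nth)
    with v interp_dom_iff[OF iso t this] show ?thesis by blast
  qed
  show "(u, u') \<in> Eqv (interp t A) \<longleftrightarrow> (v, v') \<in> Eqv (interp t B)"
    if "(u, v) \<in> ?F" "(u', v') \<in> ?F" for u v u' v'
  proof -
    have "list_all2 (\<lambda>a b. (a, b) \<in> F) (u @ u') (v @ v')"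
      using that by (blast intro: list_all2_appendI)
    moreover have "length (u @ u') = dim t + dim t"
      using that len by auto
    ultimately have "sat A (\<lambda>_. {}) (nth (u @ u')) (eq_fm t) \<longleftrightarrow> sat B (\<lambda>_. {}) (nth (v @ v')) (eq_fm t)"
      using t by (intro iso_sat[OF iso]) (auto simp: is_transl_def fo_fm_def list_all2_conv_all_nth)
    with that dom[OF that(1)] dom[OF that(2)] show ?thesis by (simp add: interp_def)
  qed
  show "us \<in> Rl (interp t A) r (length us) \<longleftrightarrow> vs \<in> Rl (interp t B) r (length us)"
    if L: "(r, length us) \<in> L" and rel: "list_all2 (\<lambda>u v. (u, v) \<in> ?F) us vs" for r us vs
  proof -
    have sub: "set us \<subseteq> interp_dom t A" "set vs \<subseteq> interp_dom t B"
      using rel dom by (fastforce simp: list_all2_conv_all_nth in_set_conv_nth)+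
    have "list_all2 (list_all2 (\<lambda>a b. (a, b) \<in> F)) us vs"
      using rel by (auto elim: list_all2_mono)
    then have "list_all2 (\<lambda>a b. (a, b) \<in> F) (concat us) (concat vs)"
      by (rule list_all2_concat)
    moreover have "length (concat us) = length us * dim t"
      using sub len by (intro concat_tuples[of "interp_dom t A"]) (auto simp: tuples_def)
    moreover have "fo_fm K (length us * dim t) (rel_fm t r (length us))"
      using t L by (auto simp: is_transl_def)
    ultimately have "sat A (\<lambda>_. {}) (nth (concat us)) (rel_fm t r (length us)) \<longleftrightarrow>
        sat B (\<lambda>_. {}) (nth (concat vs)) (rel_fm t r (length us))"
      by (intro iso_sat[OF iso]) (auto simp: fo_fm_def list_all2_conv_all_nth)
    then show ?thesis
      using sub rel by (simp add: interp_def tuples_def list_all2_lengthD)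
  qed
qed

section \<open>The quotient of a strong model as a ground model\<close>

lemma is_iso_list_dom:
  assumes "is_iso L A B F" "list_all2 (\<lambda>a b. (a, b) \<in> F) xs ys"
  shows "set xs \<subseteq> Dom A \<and> set ys \<subseteq> Dom B"
  using assms(2) by (induction rule: list_all2_induct) (use is_iso_dom[OF assms(1)] in auto)

text \<open>The quotient, realised on values of \<open>q\<close> rather than on classes so that its
  elements can be points of the universe; equality is literal, as \<open>ground_model\<close>
  demands.\<close>

definition image_struct :: "('b \<Rightarrow> 'c) \<Rightarrow> ('r, 'b) struct \<Rightarrow> ('r, 'c) struct" where
  "image_struct q A = \<lparr>Dom = q ` Dom A, Eqv = Id_on (q ` Dom A), Rl = \<lambda>r n. map q ` Rl A r n\<rparr>"

text \<open>Compatibility restricts to saturated relations, which can be recovered from their images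
  under \<open>q\<close>.\<close>

definition image_family ::
  "('b list \<Rightarrow> 'c) \<Rightarrow> ('r, 'b list) struct \<Rightarrow> 'b list set set \<Rightarrow> 'c list set set" where
  "image_family q A X = {map q ` R | R. R \<in> block_family (Dom A) X \<and> compat (Eqv A) R}"

text \<open>Equality and relations are inverse images, so \<open>h\<close> becomes an isomorphism
  modulo the two equalities without being injective, as soon as it reaches all of
  \<open>Dom N\<close>. No representatives have to be chosen.\<close>

definition pullback :: "('b \<Rightarrow> 'c) \<Rightarrow> 'b set \<Rightarrow> ('r, 'c) struct \<Rightarrow> ('r, 'b) struct" where
  "pullback h Z N =
     \<lparr>Dom = {z \<in> Z. h z \<in> Dom N}, Eqv = {(z, z'). z \<in> Z \<and> z' \<in> Z \<and> (h z, h z') \<in> Eqv N},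
      Rl = \<lambda>r n. {zs \<in> tuples n Z. map h zs \<in> Rl N r n}\<rparr>"

lemma is_struct_pullback:
  assumes N: "is_struct L N" and "Dom N \<subseteq> h ` Z"
  shows "is_struct L (pullback h Z N)"
proof -
  have eq: "equiv (Dom N) (Eqv N)" using N by (simp add: is_struct_def)
  have "equiv {z \<in> Z. h z \<in> Dom N} {(z, z'). z \<in> Z \<and> z' \<in> Z \<and> (h z, h z') \<in> Eqv N}"
  proof (rule equivI)
    show "trans {(z, z'). z \<in> Z \<and> z' \<in> Z \<and> (h z, h z') \<in> Eqv N}"
      using eq unfolding equiv_def trans_def by blast
    show "sym {(z, z'). z \<in> Z \<and> z' \<in> Z \<and> (h z, h z') \<in> Eqv N}"
      using eq unfolding equiv_def sym_def by blast
  qed (use eq in \<open>auto simp: equiv_def refl_on_def\<close>)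
  moreover have "{z \<in> Z. h z \<in> Dom N} \<noteq> {}"
    using assms by (auto simp: is_struct_def)
  moreover have "Rl (pullback h Z N) r n \<subseteq> tuples n (Dom (pullback h Z N)) \<and>
      compat (Eqv (pullback h Z N)) (Rl (pullback h Z N) r n)" if "(r, n) \<in> L" for r n
  proof
    have R: "Rl N r n \<subseteq> tuples n (Dom N)" "compat (Eqv N) (Rl N r n)"
      using N that by (auto simp: is_struct_def)
    then show "Rl (pullback h Z N) r n \<subseteq> tuples n (Dom (pullback h Z N))"
      by (fastforce simp: pullback_def tuples_def)
    show "compat (Eqv (pullback h Z N)) (Rl (pullback h Z N) r n)"
      unfolding compat_def
    proof (intro allI impI)
      fix zs ys
      assume *: "zs \<in> Rl (pullback h Z N) r n \<and> list_all2 (\<lambda>x y. (x, y) \<in> Eqv (pullback h Z N)) zs ys"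
      then have "list_all2 (\<lambda>x y. (x, y) \<in> Eqv N) (map h zs) (map h ys)" "map h zs \<in> Rl N r n"
        by (auto simp: pullback_def list_all2_conv_all_nth)
      then have "map h ys \<in> Rl N r n" using R(2) by (auto simp: compat_def)
      moreover have "ys \<in> tuples n Z"
        using * by (auto simp: pullback_def tuples_def list_all2_conv_all_nth in_set_conv_nth)
      ultimately show "ys \<in> Rl (pullback h Z N) r n" by (simp add: pullback_def)
    qed
  qed
  ultimately show ?thesis unfolding is_struct_def by (auto simp: pullback_def)
qed

lemma list_all2_graph: "list_all2 (\<lambda>a b. (a, b) \<in> (\<lambda>z. (z, h z)) ` S) xs ys \<longleftrightarrow> set xs \<subseteq> S \<and> ys = map h xs"
  by (induction xs arbitrary: ys) (auto simp: list_all2_Cons1)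

lemma is_iso_pullback:
  assumes "Dom N \<subseteq> h ` Z"
  shows "is_iso L (pullback h Z N) N ((\<lambda>z. (z, h z)) ` Dom (pullback h Z N))"
proof (rule is_isoI)
  fix r zs ys
  assume "list_all2 (\<lambda>a b. (a, b) \<in> (\<lambda>z. (z, h z)) ` Dom (pullback h Z N)) zs ys"
  then have "set zs \<subseteq> Dom (pullback h Z N)" "ys = map h zs"
    by (simp_all add: list_all2_graph)
  then show "zs \<in> Rl (pullback h Z N) r (length zs) \<longleftrightarrow> ys \<in> Rl N r (length zs)"
    by (auto simp: pullback_def tuples_def)
qed (use assms in \<open>auto simp: pullback_def image_iff subset_iff\<close>)

lemma map_eq_concat:
  "map f xs = concat us \<Longrightarrow> \<exists>yss. xs = concat yss \<and> map (map f) yss = us"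
proof (induction us arbitrary: xs)
  case (Cons u us)
  then obtain ys zs where "xs = ys @ zs" "map f ys = u" "map f zs = concat us"
    by (auto simp: map_eq_append_conv)
  moreover from Cons.IH[OF this(3)] obtain yss where "zs = concat yss" "map (map f) yss = us" by blast
  ultimately show ?case by (intro exI[of _ "ys # yss"]) simp
qed simp

lemma concat_map_concat: "concat (map concat xss) = concat (concat xss)"
  by (induction xss) auto

text \<open>Only the kernel of \<open>q\<close> is tied to \<open>X\<close>, through
  \<open>q_eq\<close> and \<open>Eqv_mem\<close>; \<open>q\<close> itself may come from the axiom of
  choice.\<close>

locale quotient_map = definable_family D X for D and X :: "'b list set set" +
  fixes A :: "('r, 'b list) struct" and q :: "'b list \<Rightarrow> 'c" and d :: nat and L
  assumes struct: "is_struct L A"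
    and Dom_mem: "Dom A \<in> X" and Dom_tuples: "Dom A \<subseteq> tuples d D" and d: "d > 0"
    and Eqv_mem: "{a @ b | a b. (a, b) \<in> Eqv A} \<in> X"
    and Rl_mem: "(r, n) \<in> L \<Longrightarrow> concat ` Rl A r n \<in> X"
    and q_eq: "a \<in> Dom A \<Longrightarrow> b \<in> Dom A \<Longrightarrow> q a = q b \<longleftrightarrow> (a, b) \<in> Eqv A"
begin

abbreviation "A' \<equiv> image_struct q A"
abbreviation "X' \<equiv> image_family q A X"
abbreviation "Y \<equiv> block_family (Dom A) X"

lemma inj_concat: "inj_on concat (lists (Dom A))"
  using Dom_tuples d by (intro inj_on_concat[of _ d]) (auto simp: tuples_def)

lemma map_q_eq:
  "set xs \<subseteq> Dom A \<Longrightarrow> set ys \<subseteq> Dom A \<Longrightarrow>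
    map q xs = map q ys \<longleftrightarrow> list_all2 (\<lambda>a b. (a, b) \<in> Eqv A) xs ys"
proof (induction xs arbitrary: ys)
  case (Cons x xs)
  then show ?case by (cases ys) (simp_all add: q_eq)
qed simp

text \<open>Tuples with the same image under \<open>q\<close> are entrywise equal in the sense of
  \<open>A\<close>, and \<open>compat\<close> closes \<open>R\<close> under such changes.\<close>

lemma map_q_mem:
  assumes "R \<in> Y" "compat (Eqv A) R" "set xs \<subseteq> Dom A"
  shows "map q xs \<in> map q ` R \<longleftrightarrow> xs \<in> R"
proof
  assume "map q xs \<in> map q ` R"
  then obtain ys where "ys \<in> R" "map q ys = map q xs" by force
  moreover have "set ys \<subseteq> Dom A" using assms(1) \<open>ys \<in> R\<close> by (auto simp: block_family_def tuples_def)
  ultimately show "xs \<in> R" using assms(2,3) map_q_eq unfolding compat_def by blast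
qed auto

text \<open>The route back from the quotient: what the hypotheses supply as a member of
  \<open>X'\<close> yields a member of \<open>X\<close> as its inverse image.\<close>

lemma pull_mem:
  assumes "S \<in> X'"
  shows "concat ` {xs \<in> lists (Dom A). map q xs \<in> S} \<in> X"
proof -
  obtain R where R: "S = map q ` R" "R \<in> Y" "compat (Eqv A) R"
    using assms by (auto simp: image_family_def)
  then have "{xs \<in> lists (Dom A). map q xs \<in> S} = R"
    using map_q_mem[OF R(2,3)] by (auto simp: block_family_def tuples_def)
  with R show ?thesis by (simp add: block_family_def)
qed

lemma is_iso_image: "is_iso L A A' ((\<lambda>a. (a, q a)) ` Dom A)"
proof (rule is_isoI)
  fix r xs ys
  assume L: "(r, length xs) \<in> L" and "list_all2 (\<lambda>a b. (a, b) \<in> (\<lambda>a. (a, q a)) ` Dom A) xs ys"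
  then have xs: "set xs \<subseteq> Dom A" and ys: "ys = map q xs"
    by (simp_all add: list_all2_graph)
  have "Rl A r (length xs) \<in> Y" "compat (Eqv A) (Rl A r (length xs))"
    using L struct Rl_mem[OF L] by (auto simp: is_struct_def block_family_def)
  from map_q_mem[OF this xs] ys
  show "xs \<in> Rl A r (length xs) \<longleftrightarrow> ys \<in> Rl A' r (length xs)" by (simp add: image_struct_def)
next
  fix a b a' b'
  assume "(a, b) \<in> (\<lambda>a. (a, q a)) ` Dom A" "(a', b') \<in> (\<lambda>a. (a, q a)) ` Dom A"
  then show "(a, a') \<in> Eqv A \<longleftrightarrow> (b, b') \<in> Eqv A'"
    using q_eq[of a a'] by (auto simp: image_struct_def Id_on_iff)
qed (auto simp: image_struct_def)

lemma definable_Y: "definable_family (Dom A) Y"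
  using Dom_mem Dom_tuples d by (rule block_family)

text \<open>A set defined over the quotient is the image of the set defined by the same formula over
  \<open>A\<close>, with parameters lifted to saturated relations. The latter lies in
  \<open>Y\<close> by \<open>definable_sat\<close> and is itself saturated.\<close>

lemma standalone_comprehension_image: "standalone_comprehension L A' X'"
  unfolding standalone_comprehension_def
proof (intro allI impI)
  fix \<phi> :: "'r fm" and n and V :: "nat \<Rightarrow> 'c list set"
  assume *: "lang \<phi> \<subseteq> L \<and> (\<forall>(p, k)\<in>pvars \<phi>. V p \<in> X') \<and> fv \<phi> \<subseteq> {..<n}"
  \<comment> \<open>The implication makes the choice total: for predicate variables that do not
    occur in the formula the lift is arbitrary.\<close>
  have "\<exists>R. (\<exists>k. (p, k) \<in> pvars \<phi>) \<longrightarrow> R \<in> Y \<and> compat (Eqv A) R \<and> V p = map q ` R" for p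
    using * by (fastforce simp: image_family_def)
  then obtain W where W: "\<And>p k. (p, k) \<in> pvars \<phi> \<Longrightarrow> W p \<in> Y \<and> compat (Eqv A) (W p) \<and> V p = map q ` W p"
    by metis
  let ?S = "{xs \<in> tuples n (Dom A). sat A W (nth xs) \<phi>}"
  have S: "?S \<in> Y"
  proof (rule definable_family.definable_sat[OF definable_Y])
    have "{[a, b] | a b. (a, b) \<in> Eqv A} \<subseteq> tuples 2 (Dom A)"
      using struct by (auto simp: is_struct_def equiv_def tuples_def)
    moreover have "concat ` {[a, b] | a b. (a, b) \<in> Eqv A} = {a @ b | a b. (a, b) \<in> Eqv A}"
      by (force simp: image_iff)
    ultimately show "{[a, b] | a b. (a, b) \<in> Eqv A} \<in> Y"
      using Eqv_mem unfolding block_family_def by auto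
    show "Rl A r k \<in> Y" if "(r, k) \<in> lang \<phi>" for r k
      using that * struct Rl_mem[of r k] by (fastforce simp: is_struct_def block_family_def)
    show "W p \<in> Y" if "(p, k) \<in> pvars \<phi>" for p k
      using W that by blast
  qed (use * in auto)
  \<comment> \<open>The equality of \<open>A\<close> acts as an automorphism and respects the
    parameters \<open>W\<close>, hence also the set they define.\<close>
  have "compat (Eqv A) ?S"
    unfolding compat_def
  proof (intro allI impI)
    fix xs ys assume xy: "xs \<in> ?S \<and> list_all2 (\<lambda>x y. (x, y) \<in> Eqv A) xs ys"
    have len: "length xs = n" "length ys = n"
      using xy by (auto simp: tuples_def list_all2_lengthD)
    have "set ys \<subseteq> Dom A"
      using xy is_iso_list_dom[OF is_iso_Eqv[OF struct]] by blast
    moreover have "sat A W (nth xs) \<phi> \<longleftrightarrow> sat A W (nth ys) \<phi>"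
    proof (rule iso_sat[OF is_iso_Eqv[OF struct]])
      fix p us vs assume p: "(p, length us) \<in> pvars \<phi>" and uv: "list_all2 (\<lambda>a b. (a, b) \<in> Eqv A) us vs"
      have "list_all2 (\<lambda>a b. (a, b) \<in> Eqv A) vs us"
        using uv struct by (auto simp: list_all2_conv_all_nth is_struct_def equiv_def dest: symD)
      with W[OF p] uv show "us \<in> W p \<longleftrightarrow> vs \<in> W p" unfolding compat_def by blast
    qed (use * xy len in \<open>auto simp: list_all2_conv_all_nth\<close>)
    ultimately show "ys \<in> ?S" using xy len by (simp add: tuples_def)
  qed
  with S have "map q ` ?S \<in> X'"
    by (auto simp: image_family_def)
  moreover have "{xs \<in> tuples n (Dom A'). sat A' V (nth xs) \<phi>} = map q ` ?S"
  proof -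
    have sat: "sat A W (nth xs) \<phi> \<longleftrightarrow> sat A' V (nth (map q xs)) \<phi>" if "xs \<in> tuples n (Dom A)" for xs
    proof (rule iso_sat[OF is_iso_image])
      fix p us vs
      assume p: "(p, length us) \<in> pvars \<phi>" and "list_all2 (\<lambda>a b. (a, b) \<in> (\<lambda>a. (a, q a)) ` Dom A) us vs"
      then show "us \<in> W p \<longleftrightarrow> vs \<in> V p"
        using W[OF p] map_q_mem[of "W p" us] by (simp add: list_all2_graph)
    qed (use * that in \<open>auto simp: tuples_def subset_iff\<close>)
    have "tuples n (Dom A') = map q ` tuples n (Dom A)"
    proof (intro equalityI subsetI)
      fix xs assume "xs \<in> tuples n (Dom A')"
      then have "xs \<in> lists (q ` Dom A)" "length xs = n"
        by (auto simp: tuples_def image_struct_def)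
      then obtain ys where "xs = map q ys" "ys \<in> lists (Dom A)" by (auto simp: lists_image)
      then show "xs \<in> map q ` tuples n (Dom A)" using \<open>length xs = n\<close> by (auto simp: tuples_def)
    qed (auto simp: tuples_def image_struct_def subset_iff)
    with sat show ?thesis by auto
  qed
  ultimately show "{xs \<in> tuples n (Dom A'). sat A' V (nth xs) \<phi>} \<in> X'" by simp
qed

lemma is_struct_image: "is_struct L A'"
proof -
  have "compat (Id_on (q ` Dom A)) S" for S
    unfolding compat_def
  proof (intro allI impI)
    fix xs ys assume *: "xs \<in> S \<and> list_all2 (\<lambda>x y. (x, y) \<in> Id_on (q ` Dom A)) xs ys"
    then have "xs = ys" by (auto simp: list_all2_conv_all_nth list_eq_iff_nth_eq Id_on_iff)
    with * show "ys \<in> S" by simp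
  qed
  moreover have "equiv (q ` Dom A) (Id_on (q ` Dom A))"
    by (auto simp: equiv_def refl_on_def sym_def trans_def)
  ultimately show ?thesis
    using struct unfolding is_struct_def image_struct_def by (fastforce simp: tuples_def)
qed

text \<open>An instance of \<open>\<sigma>\<close> at \<open>S\<close> in the quotient corresponds,
  along the projection, to the instance at the saturated lift of \<open>S\<close> in
  \<open>A\<close>, which \<open>strong_model\<close> provides.\<close>

lemma sPC_image:
  assumes "strong_model X A \<sigma>" "fv \<sigma> = {}" "lang \<sigma> = L"
  shows "sPC {\<sigma>} A' X'"
proof -
  have "holds A' (\<lambda>_. S) \<sigma>" if S: "S \<in> X'" for S
  proof -
    obtain R where R: "S = map q ` R" "R \<in> Y" "compat (Eqv A) R"
      using S by (auto simp: image_family_def)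
    then have "holds A (\<lambda>_. R) \<sigma>"
      using assms(1) by (auto simp: strong_model_def block_family_def)
    also have "holds A (\<lambda>_. R) \<sigma> \<longleftrightarrow> holds A' (\<lambda>_. S) \<sigma>"
      using assms R map_q_mem[OF R(2,3)] by (intro iso_holds[OF is_iso_image]) (auto simp: list_all2_graph)
    finally show ?thesis .
  qed
  moreover have "\<exists>n. S \<subseteq> tuples n (Dom A')" if S: "S \<in> X'" for S
  proof -
    obtain R n where "S = map q ` R" "R \<subseteq> tuples n (Dom A)"
      using S by (auto simp: image_family_def block_family_def)
    then have "S \<subseteq> tuples n (Dom A')" by (auto simp: tuples_def image_struct_def subset_iff)
    then show ?thesis by blast
  qed
  moreover have "Eqv A' = Id_on (Dom A')" by (simp add: image_struct_def)
  ultimately show ?thesis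
    using standalone_comprehension_image is_struct_image assms by (simp add: sPC_def ground_model_def)
qed

end

section \<open>Strong models over the quotient\<close>

context quotient_map
begin

text \<open>
  Elements of structures interpreted in the quotient are \<open>c\<close>-tuples of classes; over \<open>A\<close> they are
  represented by flattened \<open>c\<close>-tuples, on which \<open>block_map c\<close> is the projection to the classes.
\<close>

definition block_map :: "nat \<Rightarrow> 'b list \<Rightarrow> 'c list" where
  "block_map c z = map q (inv_into (tuples c (Dom A)) concat z)"

abbreviation lift :: "nat \<Rightarrow> ('t, 'c list) struct \<Rightarrow> ('t, 'b list) struct" where
  "lift c N \<equiv> pullback (block_map c) (concat ` tuples c (Dom A)) N"

lemma block_map_concat: "ys \<in> tuples c (Dom A) \<Longrightarrow> block_map c (concat ys) = map q ys"
  unfolding block_map_def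
  by (subst inv_into_f_f) (auto intro: inj_on_subset[OF inj_concat tuples_lists])

lemma lift_surj:
  assumes "Dom N \<subseteq> tuples c (q ` Dom A)"
  shows "Dom N \<subseteq> block_map c ` concat ` tuples c (Dom A)"
proof
  fix u assume "u \<in> Dom N"
  with assms have "u \<in> lists (q ` Dom A)" "length u = c" by (auto simp: tuples_def)
  then obtain ys where "u = map q ys" "ys \<in> lists (Dom A)" by (auto simp: lists_image)
  with \<open>length u = c\<close> have ys: "ys \<in> tuples c (Dom A)"
    by (auto simp: tuples_def)
  with \<open>u = map q ys\<close> have "u = block_map c (concat ys)"
    by (simp add: block_map_concat)
  with ys show "u \<in> block_map c ` concat ` tuples c (Dom A)" by blast
qed

lemma map_q_eq_concatE:
  assumes "map q xs = concat us" "set us \<subseteq> tuples c (q ` Dom A)" "set xs \<subseteq> Dom A"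
  obtains yss where "xs = concat yss" "set yss \<subseteq> tuples c (Dom A)" "us = map (map q) yss"
proof -
  obtain yss where yss: "xs = concat yss" "map (map q) yss = us"
    using map_eq_concat[OF assms(1)] by blast
  have "length ys = c" if "ys \<in> set yss" for ys
  proof -
    have "map q ys \<in> tuples c (q ` Dom A)" using that yss assms(2) by auto
    then show ?thesis by (simp add: tuples_def)
  qed
  then have "set yss \<subseteq> tuples c (Dom A)" using yss assms(3) by (auto simp: tuples_def)
  with yss that show thesis by blast
qed

text \<open>There are two ways back from relations on \<open>c\<close>-tuples of classes to words
  over \<open>D\<close>: flatten and then lift letters along \<open>q\<close>, or lift whole
  elements along \<open>block_map c\<close> and then flatten. \<open>pull_mem\<close> controls the
  first, while \<open>lift\<close> is defined by the second.\<close>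

lemma concat_pull:
  assumes "U \<subseteq> lists (tuples c (q ` Dom A))"
  shows "concat ` {xs \<in> lists (Dom A). map q xs \<in> concat ` U} =
    concat ` {zs \<in> lists (concat ` tuples c (Dom A)). map (block_map c) zs \<in> U}"
proof (intro equalityI subsetI)
  fix w assume "w \<in> concat ` {xs \<in> lists (Dom A). map q xs \<in> concat ` U}"
  then obtain xs us where xs: "w = concat xs" "set xs \<subseteq> Dom A" "map q xs = concat us" "us \<in> U"
    by auto
  then have "set us \<subseteq> tuples c (q ` Dom A)" using assms by auto
  with xs obtain yss where yss: "xs = concat yss" "set yss \<subseteq> tuples c (Dom A)" "us = map (map q) yss"
    by (elim map_q_eq_concatE)
  then have "map (block_map c) (map concat yss) = us"
    using block_map_concat by auto
  moreover have "w = concat (map concat yss)" using xs yss by (simp add: concat_map_concat)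
  moreover have "map concat yss \<in> lists (concat ` tuples c (Dom A))" using yss by (auto simp: subset_iff)
  ultimately show "w \<in> concat ` {zs \<in> lists (concat ` tuples c (Dom A)). map (block_map c) zs \<in> U}"
    using xs(4) by blast
next
  fix w assume "w \<in> concat ` {zs \<in> lists (concat ` tuples c (Dom A)). map (block_map c) zs \<in> U}"
  then obtain zs where zs: "w = concat zs" "zs \<in> lists (concat ` tuples c (Dom A))"
    "map (block_map c) zs \<in> U" by auto
  then obtain yss where yss: "zs = map concat yss" "yss \<in> lists (tuples c (Dom A))"
    by (auto simp: lists_image)
  then have "map (block_map c) zs = map (map q) yss"
    using block_map_concat by auto
  then have "map q (concat yss) = concat (map (block_map c) zs)"
    by (simp add: map_concat)
  moreover have "w = concat (concat yss)" using zs yss by (simp add: concat_map_concat)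
  moreover have "concat yss \<in> lists (Dom A)" using yss by (fastforce simp: tuples_def)
  ultimately show "w \<in> concat ` {xs \<in> lists (Dom A). map q xs \<in> concat ` U}"
    using zs(3) by blast
qed

text \<open>The direction opposite to \<open>pull_mem\<close>: a predicate on the lifted model is
  regrouped as a \<open>(k * c)\<close>-ary relation on \<open>A\<close>, and its compatibility with
  the equality of the lift makes the regrouped relation compatible with that of
  \<open>A\<close>.\<close>

lemma lift_instance_mem:
  assumes N: "is_struct K N" "Dom N \<subseteq> tuples c (q ` Dom A)"
    and R: "R \<subseteq> tuples k (Dom (lift c N))" "compat (Eqv (lift c N)) R" "concat ` R \<in> X"
  shows "concat ` map (block_map c) ` R \<in> X'"
proof -
  let ?h = "block_map c"
  \<comment> \<open>Each entry of a tuple in \<open>R\<close> is a flattened list of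
    \<open>c\<close> elements of \<open>A\<close>; here the same tuples are read as lists of
    \<open>k * c\<close> elements of \<open>A\<close>.\<close>
  let ?R = "{concat yss | yss. yss \<in> tuples k (tuples c (Dom A)) \<and> map concat yss \<in> R}"
  have zsE: "\<exists>yss \<in> tuples k (tuples c (Dom A)). zs = map concat yss \<and> map ?h zs = map (map q) yss"
    if "zs \<in> R" for zs
  proof -
    have "zs \<in> lists (concat ` tuples c (Dom A))" "length zs = k"
      using that R(1) by (auto simp: tuples_def pullback_def)
    then obtain yss where "zs = map concat yss" "yss \<in> lists (tuples c (Dom A))"
      by (auto simp: lists_image)
    with \<open>length zs = k\<close> show ?thesis
      by (intro bexI[of _ yss]) (auto simp: tuples_def block_map_concat)
  qed
  have "concat ` ?R = concat ` R"
  proof (intro equalityI subsetI)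
    fix w assume "w \<in> concat ` ?R"
    then show "w \<in> concat ` R" by (auto simp flip: concat_map_concat)
  next
    fix w assume "w \<in> concat ` R"
    then obtain zs where "zs \<in> R" "w = concat zs" by blast
    with zsE obtain yss where "yss \<in> tuples k (tuples c (Dom A))" "map concat yss \<in> R"
      "w = concat (concat yss)" by (metis concat_map_concat)
    then show "w \<in> concat ` ?R" by blast
  qed
  moreover have "?R \<subseteq> tuples (k * c) (Dom A)"
  proof
    fix xs assume "xs \<in> ?R"
    then obtain yss where "xs = concat yss" "yss \<in> tuples k (tuples c (Dom A))" by blast
    then show "xs \<in> tuples (k * c) (Dom A)"
      using concat_tuples[of "tuples c (Dom A)" c yss k] by (auto simp: tuples_def)
  qed
  ultimately have Y: "?R \<in> Y" using R(3) by (auto simp: block_family_def)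
  have img: "map q ` ?R = concat ` map ?h ` R"
  proof (intro equalityI subsetI)
    fix w assume "w \<in> map q ` ?R"
    then obtain yss where "w = map q (concat yss)" "yss \<in> tuples k (tuples c (Dom A))" "map concat yss \<in> R"
      by blast
    moreover from this have "map ?h (map concat yss) = map (map q) yss"
      using block_map_concat by (auto simp: tuples_def)
    ultimately have "w = concat (map ?h (map concat yss))" by (simp only: map_concat)
    then show "w \<in> concat ` map ?h ` R" using \<open>map concat yss \<in> R\<close> by blast
  next
    fix w assume "w \<in> concat ` map ?h ` R"
    then obtain zs where "zs \<in> R" "w = concat (map ?h zs)" by blast
    with zsE obtain yss where yss: "yss \<in> tuples k (tuples c (Dom A))" "map concat yss \<in> R"
      "w = concat (map (map q) yss)" by metis
    then have "w = map q (concat yss)" by (simp add: map_concat)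
    with yss(1,2) show "w \<in> map q ` ?R" by blast
  qed
  have "compat (Eqv A) ?R"
    unfolding compat_def
  proof (intro allI impI)
    fix xs xs' assume *: "xs \<in> ?R \<and> list_all2 (\<lambda>x y. (x, y) \<in> Eqv A) xs xs'"
    then have sub: "set xs \<subseteq> Dom A" "set xs' \<subseteq> Dom A"
      using is_iso_list_dom[OF is_iso_Eqv[OF struct]] by blast+
    have eq: "map q xs = map q xs'"
      using map_q_eq[OF sub] * by blast
    obtain yss where yss: "xs = concat yss" "yss \<in> tuples k (tuples c (Dom A))" "map concat yss \<in> R"
      using * by blast
    have h: "map ?h (map concat yss) = map (map q) yss"
      using yss(2) block_map_concat by (auto simp: tuples_def)
    have "set (map (map q) yss) \<subseteq> tuples c (q ` Dom A)"
      using yss(2) by (fastforce simp: tuples_def)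
    moreover have "map q xs' = concat (map (map q) yss)"
      using yss(1) eq by (simp add: map_concat)
    ultimately obtain yss' where yss': "xs' = concat yss'" "set yss' \<subseteq> tuples c (Dom A)"
      "map (map q) yss = map (map q) yss'"
      using sub(2) by (elim map_q_eq_concatE)
    have len: "length yss = k" "length yss' = k"
      using yss(2) arg_cong[OF yss'(3), of length] by (auto simp: tuples_def)
    have "list_all2 (\<lambda>x y. (x, y) \<in> Eqv (lift c N)) (map concat yss) (map concat yss')"
      unfolding list_all2_conv_all_nth
    proof (intro conjI allI impI)
      fix i assume "i < length (map concat yss)"
      then have i: "i < k" using len by simp
      have mem: "yss ! i \<in> tuples c (Dom A)" "yss' ! i \<in> tuples c (Dom A)"
        using yss(2) yss'(2) i len by (auto simp: tuples_def[of k])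
      have "map q (yss ! i) = map q (yss' ! i)"
        using arg_cong[OF yss'(3), of "\<lambda>l. l ! i"] i len by simp
      then have "?h (concat (yss ! i)) = ?h (concat (yss' ! i))"
        using mem by (simp add: block_map_concat)
      \<comment> \<open>\<open>Eqv N\<close> is reflexive only on \<open>Dom N\<close>, so equal
        projections give related elements only after membership in the domain of the lift is
        known.\<close>
      moreover have "set (map concat yss) \<subseteq> Dom (lift c N)"
        using subsetD[OF R(1) yss(3)] by (simp add: tuples_def)
      then have "map concat yss ! i \<in> Dom (lift c N)"
        by (rule subsetD[OF _ nth_mem]) (use i len in simp)
      then have "?h (concat (yss ! i)) \<in> Dom N" using i len by (simp add: pullback_def)
      moreover have "equiv (Dom N) (Eqv N)" using N(1) by (simp add: is_struct_def)
      ultimately have "(?h (concat (yss ! i)), ?h (concat (yss' ! i))) \<in> Eqv N"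
        by (metis equiv_def refl_onD)
      with mem show "(map concat yss ! i, map concat yss' ! i) \<in> Eqv (lift c N)"
        using i len by (simp add: pullback_def)
    qed (use len in simp)
    then have "map concat yss' \<in> R"
      using R(2) yss(3) unfolding compat_def by blast
    then show "xs' \<in> ?R" using yss' len by (auto simp: tuples_def[of k])
  qed
  with Y img show ?thesis unfolding image_family_def by blast
qed

text \<open>Domain, equality and relations travel from \<open>X'\<close> to \<open>X\<close> by
  \<open>concat_pull\<close>. Instances of \<open>\<tau>\<close> travel the other way: a predicate
  on the lift is pushed to \<open>N\<close> by \<open>lift_instance_mem\<close>, where
  \<open>\<tau>\<close> is known.\<close>

lemma strong_model_lift:
  assumes N: "strong_model X' N \<tau>" and sub: "Dom N \<subseteq> tuples c (q ` Dom A)" and c: "c > 0"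
    and \<tau>: "fv \<tau> = {}"
  shows "strong_model X (lift c N) \<tau>"
proof -
  let ?Z = "concat ` tuples c (Dom A)" and ?h = "block_map c"
  have str: "is_struct (lang \<tau>) N" using N by (simp add: strong_model_def)
  have surj: "Dom N \<subseteq> ?h ` ?Z" using sub by (rule lift_surj)
  \<comment> \<open>Domain and equality are read as relations on lists of length 1 and 2, so that
    \<open>pull\<close> covers them in the same way as \<open>Rl\<close>.\<close>
  have lists_U: "{[u] | u. u \<in> Dom N} \<subseteq> lists (tuples c (q ` Dom A))"
    "{[u, v] | u v. (u, v) \<in> Eqv N} \<subseteq> lists (tuples c (q ` Dom A))"
    using subsetD[OF sub] is_iso_dom[OF is_iso_Eqv[OF str]] by auto
  have lists_R: "Rl N r n \<subseteq> lists (tuples c (q ` Dom A))" if "(r, n) \<in> lang \<tau>" for r n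
    using sub str that by (fastforce simp: is_struct_def tuples_def[of n])
  have pull: "concat ` {zs \<in> lists ?Z. map ?h zs \<in> U} \<in> X"
    if "U \<subseteq> lists (tuples c (q ` Dom A))" "concat ` U \<in> X'" for U
    using pull_mem[OF that(2)] concat_pull[OF that(1)] by simp
  have "concat ` {[u] | u. u \<in> Dom N} = Dom N" by (force simp: image_iff)
  then have "concat ` {zs \<in> lists ?Z. map ?h zs \<in> {[u] | u. u \<in> Dom N}} \<in> X"
    using N by (intro pull lists_U) (simp add: strong_model_def)
  moreover have "concat ` {zs \<in> lists ?Z. map ?h zs \<in> {[u] | u. u \<in> Dom N}} = Dom (lift c N)"
    (is "concat ` ?S = _")
  proof -
    have "?S = (\<lambda>z. [z]) ` Dom (lift c N)"
      by (auto simp: pullback_def map_eq_Cons_conv)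
    then show ?thesis by (simp add: image_image)
  qed
  ultimately have 1: "Dom (lift c N) \<in> X" by simp
  have "concat ` {[u, v] | u v. (u, v) \<in> Eqv N} = {u @ v | u v. (u, v) \<in> Eqv N}"
    by (force simp: image_iff)
  then have "concat ` {zs \<in> lists ?Z. map ?h zs \<in> {[u, v] | u v. (u, v) \<in> Eqv N}} \<in> X"
    using N by (intro pull lists_U) (simp add: strong_model_def)
  moreover have "concat ` {zs \<in> lists ?Z. map ?h zs \<in> {[u, v] | u v. (u, v) \<in> Eqv N}} =
      {a @ b | a b. (a, b) \<in> Eqv (lift c N)}" (is "concat ` ?S = _")
  proof -
    have "?S = {[a, b] | a b. (a, b) \<in> Eqv (lift c N)}"
      by (auto simp: pullback_def map_eq_Cons_conv)
    then show ?thesis by (force simp: image_iff)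
  qed
  ultimately have 2: "{a @ b | a b. (a, b) \<in> Eqv (lift c N)} \<in> X" by simp
  have 3: "concat ` Rl (lift c N) r n \<in> X" if "(r, n) \<in> lang \<tau>" for r n
  proof -
    have "concat ` {zs \<in> lists ?Z. map ?h zs \<in> Rl N r n} \<in> X"
      using N that by (intro pull lists_R) (auto simp: strong_model_def)
    moreover have "Rl N r n \<subseteq> tuples n (Dom N)" using str that by (auto simp: is_struct_def)
    then have "{zs \<in> lists ?Z. map ?h zs \<in> Rl N r n} = Rl (lift c N) r n"
      by (auto simp: pullback_def tuples_def[of n])
    ultimately show ?thesis by simp
  qed
  have 4: "holds (lift c N) (\<lambda>_. R) \<tau>"
    if R: "R \<subseteq> tuples k (Dom (lift c N))" "compat (Eqv (lift c N)) R" "concat ` R \<in> X" for k R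
  proof -
    let ?R = "map ?h ` R"
    \<comment> \<open>\<open>R\<close> is saturated, because entries with the same projection are
      equal in the lift.\<close>
    have mem: "set zs \<subseteq> Dom (lift c N) \<Longrightarrow> map ?h zs \<in> ?R \<longleftrightarrow> zs \<in> R" for zs
    proof
      assume zs: "set zs \<subseteq> Dom (lift c N)" and "map ?h zs \<in> ?R"
      then obtain zs' where zs': "zs' \<in> R" "map ?h zs = map ?h zs'" by blast
      then have "set zs' \<subseteq> Dom (lift c N)" using R(1) by (auto simp: tuples_def)
      have "length zs' = length zs" using zs'(2) map_eq_imp_length_eq by metis
      moreover have "(zs' ! i, zs ! i) \<in> Eqv (lift c N)" if i: "i < length zs" for i
      proof -
        have "?h (zs ! i) = ?h (zs' ! i)"
          using arg_cong[OF zs'(2), of "\<lambda>l. l ! i"] i \<open>length zs' = length zs\<close> by simp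
        moreover have "zs ! i \<in> Dom (lift c N)" "zs' ! i \<in> Dom (lift c N)"
          using i zs \<open>set zs' \<subseteq> _\<close> \<open>length zs' = length zs\<close> by auto
        moreover have "equiv (Dom N) (Eqv N)" using str by (simp add: is_struct_def)
        ultimately show ?thesis by (auto simp: pullback_def equiv_def dest: refl_onD)
      qed
      ultimately have "list_all2 (\<lambda>x y. (x, y) \<in> Eqv (lift c N)) zs' zs"
        by (simp add: list_all2_conv_all_nth)
      then show "zs \<in> R" using R(2) zs'(1) unfolding compat_def by blast
    qed auto
    have "?R \<subseteq> tuples k (Dom N)"
      using R(1) by (fastforce simp: tuples_def pullback_def)
    moreover have "compat (Eqv N) ?R"
      unfolding compat_def
    proof (intro allI impI)
      fix us vs assume *: "us \<in> ?R \<and> list_all2 (\<lambda>x y. (x, y) \<in> Eqv N) us vs"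
      then obtain zs where zs: "zs \<in> R" "us = map ?h zs" by blast
      have "set vs \<subseteq> Dom N"
        using * is_iso_list_dom[OF is_iso_Eqv[OF str]] by blast
      moreover have "Dom N \<subseteq> ?h ` Dom (lift c N)" using surj by (auto simp: pullback_def)
      ultimately have "vs \<in> lists (?h ` Dom (lift c N))" by blast
      then obtain zs' where zs': "vs = map ?h zs'" "set zs' \<subseteq> Dom (lift c N)"
        by (auto simp: lists_image)
      have "set zs \<subseteq> Dom (lift c N)" using zs(1) R(1) by (auto simp: tuples_def)
      then have "list_all2 (\<lambda>x y. (x, y) \<in> Eqv (lift c N)) zs zs'"
        using * zs(2) zs' by (auto simp: list_all2_conv_all_nth pullback_def subset_iff)
      then have "zs' \<in> R" using R(2) zs(1) unfolding compat_def by blast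
      then show "vs \<in> ?R" using zs'(1) by blast
    qed
    moreover have "concat ` ?R \<in> X'" using str sub R by (rule lift_instance_mem)
    ultimately have "holds N (\<lambda>_. ?R) \<tau>"
      using N unfolding strong_model_def by blast
    moreover have "holds (lift c N) (\<lambda>_. R) \<tau> \<longleftrightarrow> holds N (\<lambda>_. ?R) \<tau>"
      using mem \<tau> by (intro iso_holds[OF is_iso_pullback[OF surj]]) (auto simp: list_all2_graph)
    ultimately show ?thesis by simp
  qed
  have 5: "\<forall>a\<in>Dom (lift c N). length a = c * d"
    using concat_tuples[of "Dom A" d _ c] Dom_tuples by (auto simp: pullback_def tuples_def[of d])
  have "c * d > 0" using c d by simp
  with 1 2 3 4 5 is_struct_pullback[OF str surj] show ?thesis
    unfolding strong_model_def by blast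
qed

end

section \<open>Translation of formulas\<close>

lemma finite_fv [simp]: "finite (fv \<phi>)"
  by (induction \<phi>) auto

text \<open>Capture is avoided by renaming each bound variable beyond all values of \<open>g\<close>
  on the free variables of the body; \<open>0\<close> keeps the argument of \<open>Max\<close>
  nonempty.\<close>

primrec subst :: "'r fm \<Rightarrow> (nat \<Rightarrow> nat) \<Rightarrow> 'r fm" where
  "subst (FEq i j) g = FEq (g i) (g j)"
| "subst (FRel r xs) g = FRel r (map g xs)"
| "subst (FPred p xs) g = FPred p (map g xs)"
| "subst (FNeg \<phi>) g = FNeg (subst \<phi> g)"
| "subst (FConj \<phi> \<psi>) g = FConj (subst \<phi> g) (subst \<psi> g)"
| "subst (FAll i \<phi>) g =
     (let j = Suc (Max (insert 0 (g ` fv \<phi>))) in FAll j (subst \<phi> (g(i := j))))"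

lemma fresh: "k \<in> fv \<phi> \<Longrightarrow> g k \<noteq> Suc (Max (insert 0 (g ` fv \<phi>)))"
proof -
  assume "k \<in> fv \<phi>"
  then have "g k \<le> Max (insert 0 (g ` fv \<phi>))" by (intro Max_ge) auto
  then show ?thesis by simp
qed

lemma sat_subst: "sat A V s (subst \<phi> g) \<longleftrightarrow> sat A V (s \<circ> g) \<phi>"
proof (induction \<phi> arbitrary: s g)
  case (FAll i \<phi>)
  define j where "j = Suc (Max (insert 0 (g ` fv \<phi>)))"
  have "sat A V (s(j := x) \<circ> g(i := j)) \<phi> \<longleftrightarrow> sat A V ((s \<circ> g)(i := x)) \<phi>" for x
    using fresh[of _ \<phi> g] by (intro sat_cong) (auto simp: j_def)
  then show ?case by (simp only: subst.simps Let_def sat.simps FAll.IH flip: j_def)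
qed simp_all

lemma lang_subst [simp]: "lang (subst \<phi> g) = lang \<phi>"
  by (induction \<phi> arbitrary: g) (auto simp: Let_def)

lemma pvars_subst [simp]: "pvars (subst \<phi> g) = pvars \<phi>"
  by (induction \<phi> arbitrary: g) (auto simp: Let_def)

lemma fv_subst: "fv (subst \<phi> g) \<subseteq> g ` fv \<phi>"
proof (induction \<phi> arbitrary: g)
  case (FAll i \<phi>)
  define j where "j = Suc (Max (insert 0 (g ` fv \<phi>)))"
  have "fv (subst \<phi> (g(i := j))) \<subseteq> (g(i := j)) ` fv \<phi>" by (rule FAll.IH)
  then have "fv (subst (FAll i \<phi>) g) \<subseteq> (g(i := j)) ` fv \<phi> - {j}"
    by (auto simp: Let_def j_def)
  then show ?case by auto
next
  case (FConj \<phi> \<psi>)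
  show ?case using FConj(1)[of g] FConj(2)[of g] by auto
qed auto

lemma sat_subst_nth:
  assumes "fo_fm K n \<psi>" "length g = n"
  shows "sat M W s (subst \<psi> (nth g)) \<longleftrightarrow> sat M (\<lambda>_. {}) (nth (map s g)) \<psi>"
  unfolding sat_subst using assms by (intro sat_cong) (auto simp: fo_fm_def)

abbreviation FAlls :: "nat list \<Rightarrow> 'r fm \<Rightarrow> 'r fm" where
  "FAlls is \<phi> \<equiv> foldr FAll is \<phi>"

definition upd :: "(nat \<Rightarrow> 'b) \<Rightarrow> nat \<Rightarrow> 'b list \<Rightarrow> nat \<Rightarrow> 'b" where
  "upd s j xs = (\<lambda>k. if j \<le> k \<and> k < j + length xs then xs ! (k - j) else s k)"

lemma sat_FAlls:
  "sat A V s (FAlls [j..<j + m] \<phi>) \<longleftrightarrow> (\<forall>xs\<in>tuples m (Dom A). sat A V (upd s j xs) \<phi>)"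
proof (induction m arbitrary: j s)
  case 0
  have "upd s j [] = s" by (auto simp: upd_def fun_eq_iff)
  then show ?case by simp
next
  case (Suc m)
  have upd: "upd (s(j := x)) (Suc j) xs = upd s j (x # xs)" for x xs
    by (auto simp: upd_def fun_eq_iff nth_Cons')
  have "[j..<j + Suc m] = j # [Suc j..<Suc j + m]" by (simp add: upt_rec)
  then have "sat A V s (FAlls [j..<j + Suc m] \<phi>) \<longleftrightarrow>
      (\<forall>x\<in>Dom A. \<forall>xs\<in>tuples m (Dom A). sat A V (upd s j (x # xs)) \<phi>)"
    by (simp only: foldr_Cons comp_apply sat.simps Suc.IH upd)
  moreover have "tuples (Suc m) (Dom A) = {x # xs | x xs. x \<in> Dom A \<and> xs \<in> tuples m (Dom A)}"
    by (auto simp: tuples_def length_Suc_conv)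
  ultimately show ?case by auto
qed

lemma FAlls_simps [simp]:
  "lang (FAlls is \<phi>) = lang \<phi>" "pvars (FAlls is \<phi>) = pvars \<phi>" "fv (FAlls is \<phi>) = fv \<phi> - set is"
  by (induction "is") auto

definition block :: "nat \<Rightarrow> nat \<Rightarrow> nat list" where
  "block m i = [i * m..<i * m + m]"

text \<open>The usual relative translation, variable \<open>i\<close> being represented by
  \<open>block (dim t) i\<close>. The quantifier bounded by \<open>dom_fm t\<close> is expressed
  with negation and conjunction, the connectives at hand.\<close>

primrec translate :: "('t, 's) transl \<Rightarrow> 't fm \<Rightarrow> 's fm" where
  "translate t (FEq i j) = subst (eq_fm t) (nth (block (dim t) i @ block (dim t) j))"
| "translate t (FRel r xs) = subst (rel_fm t r (length xs)) (nth (concat (map (block (dim t)) xs)))"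
| "translate t (FPred p xs) = FPred p (concat (map (block (dim t)) xs))"
| "translate t (FNeg \<phi>) = FNeg (translate t \<phi>)"
| "translate t (FConj \<phi> \<psi>) = FConj (translate t \<phi>) (translate t \<psi>)"
| "translate t (FAll i \<phi>) = FAlls (block (dim t) i)
     (FNeg (FConj (subst (dom_fm t) (nth (block (dim t) i))) (FNeg (translate t \<phi>))))"

lemma length_concat_block [simp]: "length (concat (map (block m) xs)) = length xs * m"
  by (induction xs) (auto simp: block_def)

lemma length_block [simp]: "length (block m i) = m"
  by (simp add: block_def)

lemma map_upd_block:
  assumes "length x = m"
  shows "map (upd s (i * m) x) (block m k) = (if k = i then x else map s (block m k))"
proof (cases "k = i")
  case True
  then show ?thesis using assms by (auto simp: block_def upd_def intro!: nth_equalityI)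
next
  case False
  \<comment> \<open>Division by \<open>m\<close> recovers the variable to which a position belongs,
    so distinct blocks are disjoint.\<close>
  have "\<not> (i * m \<le> j \<and> j < i * m + m)" if "j \<in> set (block m k)" for j
  proof
    assume "i * m \<le> j \<and> j < i * m + m"
    then have "j div m = i" by (intro div_nat_eqI) (auto simp: mult.commute)
    moreover have "j div m = k"
      using that by (intro div_nat_eqI) (auto simp: mult.commute block_def)
    ultimately show False using False by simp
  qed
  then show ?thesis using False assms by (auto simp: upd_def)
qed

lemma sat_translate:
  assumes t: "is_transl L K t"
    and "lang \<phi> \<subseteq> L" "pvars \<phi> = {}"
    and "\<And>i. i \<in> fv \<phi> \<Longrightarrow> s i = map s' (block (dim t) i) \<and> s i \<in> interp_dom t M"
  shows "sat (interp t M) V s \<phi> \<longleftrightarrow> sat M W s' (translate t \<phi>)"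
  using assms(2-)
proof (induction \<phi> arbitrary: s s')
  case (FEq i j)
  have "fo_fm K (dim t + dim t) (eq_fm t)" using t by (simp add: is_transl_def)
  then show ?case
    using FEq.prems(3)[of i] FEq.prems(3)[of j] by (auto simp: sat_subst_nth interp_def)
next
  case (FRel r xs)
  have fo: "fo_fm K (length xs * dim t) (rel_fm t r (length xs))"
    using t FRel.prems(1) by (auto simp: is_transl_def)
  have "map s xs = map (\<lambda>i. map s' (block (dim t) i)) xs"
    using FRel.prems(3) by simp
  then have "concat (map s xs) = map s' (concat (map (block (dim t)) xs))"
    by (simp only: map_concat map_map comp_def)
  moreover have "s i \<in> interp_dom t M" if "i \<in> set xs" for i
    using FRel.prems(3) that unfolding fv.simps by blast
  then have "map s xs \<in> tuples (length xs) (interp_dom t M)"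
    by (simp add: tuples_def image_subset_iff)
  ultimately show ?case
    by (simp add: sat_subst_nth[OF fo] interp_def)
next
  case (FAll i \<phi>)
  have fo: "fo_fm K (dim t) (dom_fm t)" using t by (simp add: is_transl_def)
  have IH: "sat (interp t M) V (s(i := x)) \<phi> \<longleftrightarrow> sat M W (upd s' (i * dim t) x) (translate t \<phi>)"
    if "x \<in> interp_dom t M" for x
  proof (rule FAll.IH)
    have "length x = dim t" using that by (simp add: interp_dom_def tuples_def)
    then show "(s(i := x)) k = map (upd s' (i * dim t) x) (block (dim t) k) \<and> (s(i := x)) k \<in> interp_dom t M"
      if "k \<in> fv \<phi>" for k
      using that FAll.prems(3)[of k] \<open>x \<in> interp_dom t M\<close>
      by (cases "k = i") (auto simp: map_upd_block)
  qed (use FAll.prems in auto)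
  have "sat M W (upd s' (i * dim t) x) (subst (dom_fm t) (nth (block (dim t) i))) \<longleftrightarrow>
      sat M (\<lambda>_. {}) (nth x) (dom_fm t)" if "x \<in> tuples (dim t) (Dom M)" for x
    using that by (simp add: sat_subst_nth[OF fo] map_upd_block tuples_def)
  then have "sat M W s' (translate t (FAll i \<phi>)) \<longleftrightarrow> (\<forall>x\<in>tuples (dim t) (Dom M).
      sat M (\<lambda>_. {}) (nth x) (dom_fm t) \<longrightarrow> sat M W (upd s' (i * dim t) x) (translate t \<phi>))"
    by (simp add: sat_FAlls[of M W s' "i * dim t" "dim t", folded block_def])
  also have "\<dots> \<longleftrightarrow> (\<forall>x\<in>interp_dom t M. sat M W (upd s' (i * dim t) x) (translate t \<phi>))"
    by (auto simp: interp_dom_def)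
  also have "\<dots> \<longleftrightarrow> sat (interp t M) V s (FAll i \<phi>)"
    using IH by (simp add: interp_def)
  finally show ?case by simp
next
  case (FConj \<phi> \<psi>)
  have "sat (interp t M) V s \<phi> \<longleftrightarrow> sat M W s' (translate t \<phi>)"
    by (intro FConj.IH(1) FConj.prems(3)) (use FConj.prems(1,2) in auto)
  moreover have "sat (interp t M) V s \<psi> \<longleftrightarrow> sat M W s' (translate t \<psi>)"
    by (intro FConj.IH(2) FConj.prems(3)) (use FConj.prems(1,2) in auto)
  ultimately show ?case by simp
qed auto

lemma translate_fo:
  assumes t: "is_transl L K t" and "lang \<phi> \<subseteq> L" "pvars \<phi> = {}"
  shows "lang (translate t \<phi>) \<subseteq> K \<and> pvars (translate t \<phi>) = {} \<and>
    fv (translate t \<phi>) \<subseteq> (\<Union>i\<in>fv \<phi>. set (block (dim t) i))"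
  using assms(2-)
proof (induction \<phi>)
  case (FEq i j)
  have "fo_fm K (dim t + dim t) (eq_fm t)" using t by (simp add: is_transl_def)
  moreover from this have "nth (block (dim t) i @ block (dim t) j) ` fv (eq_fm t) \<subseteq>
      set (block (dim t) i @ block (dim t) j)"
    by (intro image_subsetI nth_mem) (auto simp: fo_fm_def)
  ultimately show ?case
    using fv_subst[of "eq_fm t" "nth (block (dim t) i @ block (dim t) j)"] by (auto simp: fo_fm_def)
next
  case (FRel r xs)
  let ?b = "concat (map (block (dim t)) xs)"
  have "fo_fm K (length xs * dim t) (rel_fm t r (length xs))"
    using t FRel.prems(1) by (auto simp: is_transl_def)
  moreover from this have "nth ?b ` fv (rel_fm t r (length xs)) \<subseteq> set ?b"
    by (intro image_subsetI nth_mem) (auto simp: fo_fm_def)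
  ultimately show ?case
    using fv_subst[of "rel_fm t r (length xs)" "nth ?b"] by (auto simp: fo_fm_def)
next
  case (FAll i \<phi>)
  have "fo_fm K (dim t) (dom_fm t)" using t by (simp add: is_transl_def)
  moreover from this have "nth (block (dim t) i) ` fv (dom_fm t) \<subseteq> set (block (dim t) i)"
    by (intro image_subsetI nth_mem) (auto simp: fo_fm_def)
  with fv_subst have "fv (subst (dom_fm t) (nth (block (dim t) i))) \<subseteq> set (block (dim t) i)"
    by (rule subset_trans)
  moreover have "lang (translate t \<phi>) \<subseteq> K \<and> pvars (translate t \<phi>) = {} \<and>
    fv (translate t \<phi>) \<subseteq> (\<Union>i\<in>fv \<phi>. set (block (dim t) i))"
    using FAll by simp
  ultimately show ?case
    by (auto simp: fo_fm_def)
qed auto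

lemma holds_translate:
  assumes "is_transl L K t" "lang \<phi> \<subseteq> L" "pvars \<phi> = {}" "fv \<phi> = {}"
  shows "holds (interp t M) V \<phi> \<longleftrightarrow> holds M W (translate t \<phi>)"
proof -
  have "fv (translate t \<phi>) = {}" using translate_fo[OF assms(1-3)] assms(4) by simp
  then show ?thesis
    using sat_translate[OF assms(1-3), of "\<lambda>_. undefined" "\<lambda>_. undefined" M V W] assms(4)
    by (metis empty_iff holds_iff_sat)
qed

section \<open>Retracts\<close>

context definable_family
begin

text \<open>The fixed length \<open>i\<close> makes the splitting of a concatenated word unique, so
  coding pairs as words loses nothing.\<close>

lemma append_mem_iff:
  assumes "P \<subseteq> tuples i D \<times> tuples k D" "length a = i"
  shows "a @ b \<in> {a @ b | a b. (a, b) \<in> P} \<longleftrightarrow> (a, b) \<in> P"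
proof
  assume "a @ b \<in> {a @ b | a b. (a, b) \<in> P}"
  then obtain a' b' where *: "a @ b = a' @ b'" "(a', b') \<in> P" by blast
  then have "length a' = i" using assms(1) by (auto simp: tuples_def)
  with * assms(2) show "(a, b) \<in> P" by simp
qed blast

lemma relcomp_append_mem:
  assumes "{a @ b | a b. (a, b) \<in> P} \<in> X" "P \<subseteq> tuples i D \<times> tuples k D"
    and "{b @ c | b c. (b, c) \<in> Q} \<in> X" "Q \<subseteq> tuples k D \<times> tuples j D"
  shows "{a @ c | a c. (a, c) \<in> P O Q} \<in> X"
proof -
  have "(\<exists>b\<in>tuples k D. a @ b \<in> {a @ b | a b. (a, b) \<in> P} \<and> b @ c \<in> {b @ c | b c. (b, c) \<in> Q}) \<longleftrightarrow>
      (a, c) \<in> P O Q" if "a \<in> tuples i D" "c \<in> tuples j D" for a c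
  proof -
    have "a @ b \<in> {a @ b | a b. (a, b) \<in> P} \<longleftrightarrow> (a, b) \<in> P"
      "b @ c \<in> {b @ c | b c. (b, c) \<in> Q} \<longleftrightarrow> (b, c) \<in> Q" if "b \<in> tuples k D" for b
      using append_mem_iff[OF assms(2)] append_mem_iff[OF assms(4)] that \<open>a \<in> _\<close>
      by (auto simp: tuples_def)
    then show ?thesis using assms(2) by blast
  qed
  then have "{a @ c | a c. a \<in> tuples i D \<and> c \<in> tuples j D \<and> (\<exists>b\<in>tuples k D.
      a @ b \<in> {a @ b | a b. (a, b) \<in> P} \<and> b @ c \<in> {b @ c | b c. (b, c) \<in> Q})} =
    {a @ c | a c. (a, c) \<in> P O Q}"
    using assms(2,4) by blast
  with relcomp_mem[OF assms(1,3), of i j k] show ?thesis by simp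
qed

lemma converse_append_mem:
  assumes "{a @ b | a b. (a, b) \<in> P} \<in> X" "P \<subseteq> tuples i D \<times> tuples k D"
  shows "{b @ a | b a. (b, a) \<in> P\<inverse>} \<in> X"
proof -
  have "a @ b \<in> {a @ b | a b. (a, b) \<in> P} \<longleftrightarrow> (a, b) \<in> P" if "a \<in> tuples i D" for a b
    using append_mem_iff[OF assms(2)] that by (auto simp: tuples_def)
  then have "{b @ a | a b. a \<in> tuples i D \<and> b \<in> tuples k D \<and> a @ b \<in> {a @ b | a b. (a, b) \<in> P}} =
      {b @ a | b a. (b, a) \<in> P\<inverse>}"
    using assms(2) by blast
  with converse_mem[OF assms(1), of i k] show ?thesis by simp
qed

lemma strong_model_tuples:
  assumes "strong_model X A \<sigma>"
  obtains d where "d > 0" "Dom A \<subseteq> tuples d D"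
proof -
  obtain d where d: "d > 0" "\<forall>a\<in>Dom A. length a = d"
    using assms by (auto simp: strong_model_def)
  obtain n where "Dom A \<subseteq> tuples n D"
    using assms mem_tuples[of "Dom A"] by (auto simp: strong_model_def)
  with d have "Dom A \<subseteq> tuples d D" by (auto simp: tuples_def)
  with d that show thesis by blast
qed

lemma strong_model_quotient:
  fixes A :: "('r, 'b list) struct"
  assumes "infinite (UNIV :: 'b set)" and A: "strong_model X A \<sigma>"
  obtains q :: "'b list \<Rightarrow> 'b" and d where "quotient_map D X A q d (lang \<sigma>)"
proof -
  obtain d where d: "d > 0" "Dom A \<subseteq> tuples d D" using strong_model_tuples[OF A] .
  obtain f :: "'b list \<Rightarrow> 'b" where f: "inj_on f {xs. length xs = d}"
    using ex_inj_on_lists[OF assms(1)] by blast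
  \<comment> \<open>The choice depends on the class only, so equal elements of \<open>A\<close>
    receive literally the same representative.\<close>
  define rep where "rep a = (SOME b. b \<in> Eqv A `` {a})" for a
  have eq: "equiv (Dom A) (Eqv A)" using A by (simp add: strong_model_def is_struct_def)
  have rep: "(a, rep a) \<in> Eqv A" if "a \<in> Dom A" for a
    using someI[of "\<lambda>b. b \<in> Eqv A `` {a}", OF equiv_class_self[OF eq that]] by (simp add: rep_def)
  have "f (rep a) = f (rep b) \<longleftrightarrow> (a, b) \<in> Eqv A" if "a \<in> Dom A" "b \<in> Dom A" for a b
  proof
    assume "f (rep a) = f (rep b)"
    moreover have "rep a \<in> Dom A" "rep b \<in> Dom A"
      using rep[OF that(1)] rep[OF that(2)] equiv_type[OF eq] by blast+
    ultimately have "rep a = rep b"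
      using d(2) by (intro inj_onD[OF f]) (auto simp: tuples_def)
    then show "(a, b) \<in> Eqv A"
      using rep[OF that(1)] rep[OF that(2)] eq by (metis equiv_def symD transD)
  next
    assume "(a, b) \<in> Eqv A"
    then have "Eqv A `` {a} = Eqv A `` {b}" by (rule equiv_class_eq[OF eq])
    then show "f (rep a) = f (rep b)" by (simp add: rep_def)
  qed
  then have "quotient_map D X A (\<lambda>a. f (rep a)) d (lang \<sigma>)"
    using A d by unfold_locales (auto simp: strong_model_def)
  then show thesis by (rule that)
qed

end

text \<open>\<open>F\<close> pairs one point of the quotient with a tuple of elements of
  \<open>N\<close>, each a \<open>c\<close>-tuple of points. Lifting the word
  \<open>x # concat b\<close> letter by letter turns the point into an element of \<open>A\<close>
  and each entry of \<open>b\<close> into a flattened \<open>c\<close>-tuple of such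
  elements.\<close>

lemma (in quotient_map) retract_pull_mem:
  assumes "{x # concat b | x b. (x, b) \<in> F} \<in> X'"
    and F: "\<And>x b. (x, b) \<in> F \<Longrightarrow> x \<in> q ` Dom A \<and> set b \<subseteq> Dom N"
    and sub: "Dom N \<subseteq> tuples c (q ` Dom A)"
  shows "{a @ concat y | a y. a \<in> Dom A \<and> set y \<subseteq> Dom (lift c N) \<and> (q a, map (block_map c) y) \<in> F} \<in> X"
    (is "?S \<in> X")
proof -
  define T where "T = {x # concat b | x b. (x, b) \<in> F}"
  have T_iff: "w \<in> T \<longleftrightarrow> (\<exists>x b. w = x # concat b \<and> (x, b) \<in> F)" for w
    by (auto simp: T_def)
  have "concat ` {xs \<in> lists (Dom A). map q xs \<in> T} = ?S"
  proof (intro equalityI subsetI)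
    fix w assume "w \<in> concat ` {xs \<in> lists (Dom A). map q xs \<in> T}"
    then obtain xs where w: "w = concat xs" and *: "xs \<in> {xs \<in> lists (Dom A). map q xs \<in> T}"
      by (rule imageE)
    then obtain x b where "map q xs = x # concat b" "(x, b) \<in> F" by (auto simp: T_iff)
    with w * have xs: "w = concat xs" "set xs \<subseteq> Dom A" "map q xs = x # concat b" "(x, b) \<in> F"
      by auto
    then obtain a zs where a: "xs = a # zs" "q a = x" "map q zs = concat b"
      by (auto simp: map_eq_Cons_conv)
    moreover have "set b \<subseteq> tuples c (q ` Dom A)" using F[OF xs(4)] sub by blast
    moreover have "set zs \<subseteq> Dom A" using xs(2) a(1) by simp
    ultimately obtain yss where yss: "zs = concat yss" "set yss \<subseteq> tuples c (Dom A)" "b = map (map q) yss"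
      by (elim map_q_eq_concatE)
    have "map (block_map c) (map concat yss) = b"
      using yss block_map_concat by auto
    moreover have "set (map concat yss) \<subseteq> Dom (lift c N)"
    proof -
      have "block_map c (concat ys) \<in> Dom N" if "ys \<in> set yss" for ys
        using that yss F[OF xs(4)] block_map_concat[of ys c] by auto
      then show ?thesis using yss(2) by (auto simp: pullback_def)
    qed
    moreover have "w = a @ concat (map concat yss)" using xs a yss by (simp add: concat_map_concat)
    moreover have "a \<in> Dom A" "(q a, b) \<in> F" using xs a by simp_all
    ultimately show "w \<in> ?S" by blast
  next
    fix w assume "w \<in> ?S"
    then obtain a y where y: "w = a @ concat y" "a \<in> Dom A" "set y \<subseteq> Dom (lift c N)"
      "(q a, map (block_map c) y) \<in> F" by blast
    then have "y \<in> lists (concat ` tuples c (Dom A))" by (auto simp: pullback_def)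
    then obtain yss where yss: "y = map concat yss" "yss \<in> lists (tuples c (Dom A))"
      by (auto simp: lists_image)
    then have "map (block_map c) y = map (map q) yss" using block_map_concat by auto
    then have "map q (a # concat yss) = q a # concat (map (block_map c) y)" by (simp add: map_concat)
    with y(4) have "map q (a # concat yss) \<in> T" unfolding T_iff by metis
    moreover have "w = concat (a # concat yss)" using y yss by (simp add: concat_map_concat)
    moreover have "a # concat yss \<in> lists (Dom A)" using y yss by (fastforce simp: tuples_def)
    ultimately show "w \<in> concat ` {xs \<in> lists (Dom A). map q xs \<in> T}" by blast
  qed
  with pull_mem[OF assms(1)[folded T_def]] show ?thesis by simp
qed

text \<open>\<open>B\<close> is not literally \<open>interp t A\<close>, whose elements are lists of
  lists, but the lift of the structure interpreted in the quotient. \<open>P\<close> is the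
  projection of \<open>A\<close> to its quotient, then the given \<open>F\<close>, then the map
  which the inverse of the projection from \<open>B\<close> induces under \<open>s\<close>.\<close>

lemma retract_strong_model:
  fixes X :: "'a list set set" and A :: "('s, 'a list) struct"
  assumes inf: "infinite (UNIV :: 'a set)" and D: "definable_family D X"
    and fv: "fv \<sigma> = {}" "fv \<tau> = {}"
    and t: "interprets TYPE('a) \<sigma> \<tau> t" and s: "is_transl (lang \<sigma>) (lang \<tau>) s"
    and ret: "\<And>(M :: ('s, 'a) struct) X. sPC {\<sigma>} M X \<Longrightarrow>
      \<exists>F. is_iso (lang \<sigma>) M (interp s (interp t M)) F \<and> {x # concat b | x b. (x, b) \<in> F} \<in> X"
    and A: "strong_model X A \<sigma>"
  obtains B P where "strong_model X B \<tau>" "is_iso (lang \<sigma>) A (interp s B) P"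
    "{a @ concat y | a y. (a, y) \<in> P} \<in> X"
proof -
  interpret definable_family D X by (rule D)
  obtain q :: "'a list \<Rightarrow> 'a" and d where "quotient_map D X A q d (lang \<sigma>)"
    using strong_model_quotient[OF inf A] .
  then interpret Q: quotient_map D X A q d "lang \<sigma>" .
  let ?c = "dim t"
  let ?N = "interp t Q.A'"
  let ?B = "Q.lift ?c ?N"
  have sPC: "sPC {\<sigma>} Q.A' Q.X'" using A fv by (intro Q.sPC_image) auto
  have N: "strong_model Q.X' ?N \<tau>" using t sPC by (simp add: interprets_def)
  have sub: "Dom ?N \<subseteq> tuples ?c (q ` Dom A)"
    by (auto simp: interp_def interp_dom_def image_struct_def)
  have B: "strong_model X ?B \<tau>"
    using N sub fv t by (intro Q.strong_model_lift) (auto simp: interprets_def is_transl_def)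
  obtain F where F: "is_iso (lang \<sigma>) Q.A' (interp s ?N) F" "{x # concat b | x b. (x, b) \<in> F} \<in> Q.X'"
    using ret[OF sPC] by blast
  have F_dom: "x \<in> q ` Dom A \<and> set b \<subseteq> Dom ?N \<and> b \<in> interp_dom s ?N" if "(x, b) \<in> F" for x b
    using is_iso_dom[OF F(1) that] by (simp add: interp_def[of s] interp_dom_def[of s] tuples_def image_struct_def)
  let ?h = "Q.block_map ?c"
  let ?H = "(\<lambda>z. (z, ?h z)) ` Dom ?B"
  have H: "is_iso (lang \<tau>) ?N ?B (?H\<inverse>)"
    by (intro is_iso_converse is_iso_pullback Q.lift_surj sub)
  let ?P = "((\<lambda>a. (a, q a)) ` Dom A) O F O
    {(u, v). u \<in> interp_dom s ?N \<and> list_all2 (\<lambda>a b. (a, b) \<in> ?H\<inverse>) u v}"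
  have "is_iso (lang \<sigma>) A (interp s ?B) ?P"
    by (intro is_iso_relcomp[OF Q.is_iso_image] is_iso_relcomp[OF F(1)] is_iso_interp[OF H s])
  \<comment> \<open>The intermediate terms of the composition are determined by \<open>a\<close> and
    \<open>y\<close>, which yields the form handled by \<open>retract_pull_mem\<close>.\<close>
  moreover have "?P = {(a, y). a \<in> Dom A \<and> set y \<subseteq> Dom ?B \<and> (q a, map ?h y) \<in> F}"
    using F_dom list_all2_converse[of ?H] list_all2_graph[of ?h "Dom ?B"] by (auto simp: relcomp_unfold)
  then have "{a @ concat y | a y. (a, y) \<in> ?P} \<in> X"
    using Q.retract_pull_mem[OF F(2) _ sub] F_dom by simp
  ultimately show thesis using that B by blast
qed

text \<open>The isomorphism runs from \<open>A\<close> over \<open>interp s A'\<close> and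
  \<open>interp s B'\<close> to \<open>B\<close>; the work lies in placing the composite in
  \<open>X\<close>. For elementary equivalence it is enough to evaluate
  \<open>translate s \<phi>\<close> in \<open>A'\<close> and \<open>B'\<close>.\<close>

lemma retract_transfer:
  fixes X :: "'a list set set" and \<sigma> :: "'s fm" and \<tau> :: "'t fm"
  assumes inf: "infinite (UNIV :: 'a set)" and D: "definable_family D X"
    and fv: "fv \<sigma> = {}" "fv \<tau> = {}" and ret: "retract TYPE('a) \<sigma> \<tau>"
  shows "strong_models_isomorphic X \<tau> \<Longrightarrow> strong_models_isomorphic X \<sigma>"
    and "strong_models_equivalent X \<tau> \<Longrightarrow> strong_models_equivalent X \<sigma>"
proof -
  interpret definable_family D X by (rule D)
  obtain t s where t: "interprets TYPE('a) \<sigma> \<tau> t" and s: "is_transl (lang \<sigma>) (lang \<tau>) s"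
    and ts: "\<And>(M :: ('s, 'a) struct) X. sPC {\<sigma>} M X \<Longrightarrow>
      \<exists>F. is_iso (lang \<sigma>) M (interp s (interp t M)) F \<and> {x # concat b | x b. (x, b) \<in> F} \<in> X"
    using ret by (auto simp: retract_def interprets_def)
  note lifting = retract_strong_model[OF inf D fv t s ts]
  show "strong_models_isomorphic X \<sigma>" if iso: "strong_models_isomorphic X \<tau>"
    unfolding strong_models_isomorphic_def
  proof (intro allI impI)
    fix A B :: "('s, 'a list) struct" assume AB: "strong_model X A \<sigma> \<and> strong_model X B \<sigma>"
    obtain A' P where A': "strong_model X A' \<tau>" "is_iso (lang \<sigma>) A (interp s A') P"
      "{a @ concat y | a y. (a, y) \<in> P} \<in> X"
      using lifting AB by blast
    obtain B' Q where B': "strong_model X B' \<tau>" "is_iso (lang \<sigma>) B (interp s B') Q"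
      "{b @ concat y | b y. (b, y) \<in> Q} \<in> X"
      using lifting AB by blast
    obtain G where G: "is_iso (lang \<tau>) A' B' G" "{a @ b | a b. (a, b) \<in> G} \<in> X"
      using iso A' B' unfolding strong_models_isomorphic_def by blast
    obtain i where i: "Dom A \<subseteq> tuples i D" using strong_model_tuples AB by metis
    obtain j where j: "Dom B \<subseteq> tuples j D" using strong_model_tuples AB by metis
    obtain p where p: "p > 0" "Dom A' \<subseteq> tuples p D" using strong_model_tuples A' by metis
    obtain r where r: "r > 0" "Dom B' \<subseteq> tuples r D" using strong_model_tuples B' by metis
    define m where "m = dim s"
    define G' where "G' = {(u, v). u \<in> interp_dom s A' \<and> list_all2 (\<lambda>a b. (a, b) \<in> G) u v}"
    have G': "is_iso (lang \<sigma>) (interp s A') (interp s B') G'"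
      unfolding G'_def by (rule is_iso_interp[OF G(1) s])
    have inj: "inj_on concat (lists (Dom A'))" "inj_on concat (lists (Dom B'))"
      using inj_on_concat[of "Dom A'" p] inj_on_concat[of "Dom B'" r] p r by (auto simp: tuples_def)
    have concat_dom: "concat u \<in> tuples (length u * k) D" if "set u \<subseteq> E" "E \<subseteq> tuples k D" for u E k
    proof -
      have "length (concat u) = length u * k"
        using that by (intro concat_tuples[of E]) (auto simp: tuples_def)
      then show ?thesis using that by (fastforce simp: tuples_def)
    qed
    have P: "a \<in> Dom A \<and> set y \<subseteq> Dom A' \<and> length y = m" if "(a, y) \<in> P" for a y
      using is_iso_dom[OF A'(2) that] by (simp add: interp_def interp_dom_def tuples_def m_def)
    have Q: "b \<in> Dom B \<and> set y \<subseteq> Dom B' \<and> length y = m" if "(b, y) \<in> Q" for b y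
      using is_iso_dom[OF B'(2) that] by (simp add: interp_def interp_dom_def tuples_def m_def)
    \<comment> \<open>Flattened copies of \<open>P\<close>, \<open>Q\<close> and \<open>G'\<close>:
      \<open>relcomp_append_mem\<close> composes relations between words over \<open>D\<close>, not
      between lists of words.\<close>
    let ?P = "{(a, concat y) | a y. (a, y) \<in> P}"
    let ?Q = "{(b, concat y) | b y. (b, y) \<in> Q}"
    let ?G = "{(concat u, concat v) | u v. length u = m \<and> list_all2 (\<lambda>a b. (a, b) \<in> G) u v}"
    have P_sub: "?P \<subseteq> tuples i D \<times> tuples (m * p) D"
      using P i concat_dom[OF _ p(2)] by fastforce
    have Q_sub: "?Q \<subseteq> tuples j D \<times> tuples (m * r) D"
      using Q j concat_dom[OF _ r(2)] by fastforce
    have G_sub: "?G \<subseteq> tuples (m * p) D \<times> tuples (m * r) D"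
    proof clarify
      fix u v assume "list_all2 (\<lambda>a b. (a, b) \<in> G) u v" "m = length u"
      then show "concat u \<in> tuples (length u * p) D \<and> concat v \<in> tuples (length u * r) D"
        using is_iso_list_dom[OF G(1)] concat_dom[OF _ p(2), of u] concat_dom[OF _ r(2), of v]
        by (metis list_all2_lengthD)
    qed
    have "{a @ b | a b. (a, b) \<in> ?P} = {a @ concat y | a y. (a, y) \<in> P}"
      "{a @ b | a b. (a, b) \<in> ?Q} = {a @ concat y | a y. (a, y) \<in> Q}"
      "{a @ b | a b. (a, b) \<in> ?G} = {concat u @ concat v | u v. length u = m \<and> list_all2 (\<lambda>a b. (a, b) \<in> G) u v}"
      by blast+
    moreover have "G \<subseteq> tuples p D \<times> tuples r D"
      using is_iso_dom[OF G(1)] subsetD[OF p(2)] subsetD[OF r(2)] by auto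
    ultimately have mem: "{a @ b | a b. (a, b) \<in> ?P} \<in> X" "{a @ b | a b. (a, b) \<in> ?Q} \<in> X"
      "{a @ b | a b. (a, b) \<in> ?G} \<in> X"
      using A'(3) B'(3) listrel_mem[OF G(2)] by simp_all
    \<comment> \<open>In the flattened composition the intermediate words might split in different
      ways; injectivity of \<open>concat\<close> over \<open>Dom A'\<close> and
      \<open>Dom B'\<close> excludes this.\<close>
    have "?P O ?G O ?Q\<inverse> = P O G' O Q\<inverse>"
    proof (intro equalityI subrelI)
      fix a b assume "(a, b) \<in> ?P O ?G O ?Q\<inverse>"
      then obtain y u v z where *: "(a, y) \<in> P" "concat y = concat u" "length u = m"
        "list_all2 (\<lambda>a b. (a, b) \<in> G) u v" "concat v = concat z" "(b, z) \<in> Q"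
        by blast
      have "y = u" "v = z"
        using inj_onD[OF inj(1) *(2)] inj_onD[OF inj(2) *(5)] P[OF *(1)] Q[OF *(6)]
          is_iso_list_dom[OF G(1) *(4)] by auto
      moreover have "y \<in> interp_dom s A'"
        using is_iso_dom[OF A'(2) *(1)] by (simp add: interp_def)
      ultimately show "(a, b) \<in> P O G' O Q\<inverse>" using * by (auto simp: G'_def)
    next
      fix a b assume "(a, b) \<in> P O G' O Q\<inverse>"
      then show "(a, b) \<in> ?P O ?G O ?Q\<inverse>" using P by (fastforce simp: G'_def)
    qed
    moreover have "{a @ c | a c. (a, c) \<in> ?P O ?G O ?Q\<inverse>} \<in> X"
    proof (rule relcomp_append_mem[OF mem(1) P_sub])
      show "{b @ c | b c. (b, c) \<in> ?G O ?Q\<inverse>} \<in> X"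
        by (rule relcomp_append_mem[OF mem(3) G_sub converse_append_mem[OF mem(2) Q_sub]]) (use Q_sub in blast)
      show "?G O ?Q\<inverse> \<subseteq> tuples (m * p) D \<times> tuples j D"
        using G_sub Q_sub by blast
    qed
    moreover have "is_iso (lang \<sigma>) A B (P O G' O Q\<inverse>)"
      by (intro is_iso_relcomp[OF A'(2)] is_iso_relcomp[OF G'] is_iso_converse B'(2))
    ultimately show "\<exists>F. is_iso (lang \<sigma>) A B F \<and> {a @ b | a b. (a, b) \<in> F} \<in> X" by auto
  qed
  show "strong_models_equivalent X \<sigma>" if equiv: "strong_models_equivalent X \<tau>"
    unfolding strong_models_equivalent_def elem_equiv_def
  proof (intro allI impI)
    fix A B :: "('s, 'a list) struct" and \<phi> :: "'s fm"
    assume AB: "strong_model X A \<sigma> \<and> strong_model X B \<sigma>"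
      and \<phi>: "fv \<phi> = {} \<and> pvars \<phi> = {} \<and> lang \<phi> \<subseteq> lang \<sigma>"
    obtain A' P where A': "strong_model X A' \<tau>" "is_iso (lang \<sigma>) A (interp s A') P"
      using lifting AB by blast
    obtain B' Q where B': "strong_model X B' \<tau>" "is_iso (lang \<sigma>) B (interp s B') Q"
      using lifting AB by blast
    have "elem_equiv (lang \<tau>) A' B'" using equiv A' B' by (simp add: strong_models_equivalent_def)
    moreover have "lang (translate s \<phi>) \<subseteq> lang \<tau>" "pvars (translate s \<phi>) = {}" "fv (translate s \<phi>) = {}"
      using translate_fo[OF s, of \<phi>] \<phi> by auto
    ultimately have "holds A' (\<lambda>_. {}) (translate s \<phi>) \<longleftrightarrow> holds B' (\<lambda>_. {}) (translate s \<phi>)"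
      by (simp add: elem_equiv_def)
    moreover have "holds A (\<lambda>_. {}) \<phi> \<longleftrightarrow> holds (interp s A') (\<lambda>_. {}) \<phi>"
      by (rule iso_holds[OF A'(2)]) (use \<phi> in simp_all)
    moreover have "holds B (\<lambda>_. {}) \<phi> \<longleftrightarrow> holds (interp s B') (\<lambda>_. {}) \<phi>"
      by (rule iso_holds[OF B'(2)]) (use \<phi> in simp_all)
    moreover have "holds (interp s C) (\<lambda>_. {}) \<phi> \<longleftrightarrow> holds C (\<lambda>_. {}) (translate s \<phi>)"
      for C :: "('t, 'a list) struct"
      using \<phi> by (intro holds_translate[OF s]) auto
    ultimately show "holds A (\<lambda>_. {}) \<phi> \<longleftrightarrow> holds B (\<lambda>_. {}) \<phi>" by simp
  qed
qed

theorem mainTheorem2: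
  fixes \<sigma> :: "'s fm" and \<tau> :: "'t fm" and T :: "'u fm set"
  assumes "infinite (UNIV :: 'a set)"
    and "scheme \<sigma>" and "scheme \<tau>"
    and "retract TYPE('a) \<sigma> \<tau>"
    and "countable T" and "\<forall>\<theta>\<in>T. scheme \<theta>"
  shows "(categorical TYPE('a) \<tau> T \<longrightarrow> categorical TYPE('a) \<sigma> T) \<and>
    (standalone_categorical TYPE('a) \<tau> T \<longrightarrow> standalone_categorical TYPE('a) \<sigma> T) \<and>
    (complete TYPE('a) \<tau> T \<longrightarrow> complete TYPE('a) \<sigma> T) \<and>
    (standalone_complete TYPE('a) \<tau> T \<longrightarrow> standalone_complete TYPE('a) \<sigma> T)"
proof -
  have fv: "fv \<sigma> = {}" "fv \<tau> = {}" using assms by (auto simp: scheme_def)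
  have D: "definable_family (Dom M) X" if "sPC T M X" for M :: "('u, 'a) struct" and X
    using that by (intro standalone_comprehension_definable_family) (auto simp: sPC_def ground_model_def)
  \<comment> \<open>Comprehension with the empty list of first-order parameters is standalone
    comprehension, so every model of \<open>PC\<close> falls under the closure properties derived
    for \<open>sPC\<close>.\<close>
  have PC: "sPC T M X" if "PC T M X" for M :: "('u, 'a) struct" and X
  proof -
    have "standalone_comprehension L M X" if compr: "comprehension L M X" for L
      unfolding standalone_comprehension_def
    proof (intro allI impI)
      fix \<phi> n V
      assume "lang \<phi> \<subseteq> L \<and> (\<forall>(p, k)\<in>pvars \<phi>. V p \<in> X) \<and> fv \<phi> \<subseteq> {..<n}"
      then show "{xs \<in> tuples n (Dom M). sat M V (nth xs) \<phi>} \<in> X"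
        using compr[unfolded comprehension_def, rule_format, of \<phi> V "[]" n] by simp
    qed
    with that show ?thesis by (simp add: PC_def sPC_def)
  qed
  note transfer = retract_transfer[OF assms(1) D fv assms(4)]
  show ?thesis
    unfolding categorical_def standalone_categorical_def complete_def standalone_complete_def
    using transfer PC by blast
qed

end
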